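(* For any $\Psi\cup\{\alpha\}\subseteq\mathscr{L}_{\mathsf{MCB}}$ and $\Omega\cup\{\beta\}\subseteq\mathscr{L}_{\mathsf{NMCB}}$: $$\Psi\vdash_{\mathcal{H}\mathsf{MCB}}\alpha\ \text{ iff }\ \Psi\models_{\mathsf{MCB}}\alpha,\qquad\qquad\Omega\vdash_{\mathcal{H}\mathsf{NMCB}}\beta\ \text{ iff }\ \Omega\models_{\mathsf{NMCB}}\beta.$$
   Context: Inner layer (Belnap--Dunn logic $\mathsf{BD}$): formulas $\mathscr{L}_{\mathsf{BD}}$: $\phi::=p\in\mathtt{Prop}\mid\neg\phi\mid(\phi\wedge\phi)\mid(\phi\vee\phi)$ ($\mathtt{Prop}$ countable). A $\mathsf{BD}$ model is $\langle W,v^+,v^-\rangle$, $W\neq\varnothing$, $v^+,v^-:\mathtt{Prop}\to2^W$. Supports: $w\vDash^+p$ iff $w\in v^+(p)$; $w\vDash^-p$ iff $w\in v^-(p)$; $w\vDash^{+}\neg\phi$ iff $w\vDash^-\phi$; $w\vDash^-\neg\phi$ iff $w\vDash^+\phi$; $w\vDash^+\phi\wedge\phi'$ iff both are positively supported; $w\vDash^-\phi\wedge\phi'$ iff $w\vDash^-\phi$ or $w\vDash^-\phi'$; $w\vDash^+\phi\vee\phi'$ iff $w\vDash^+\phi$ or $w\vDash^+\phi'$; $w\vDash^-\phi\vee\phi'$ iff both are negatively supported. $|\phi|^{\pm}=\{w\in W:w\vDash^{\pm}\phi\}$. The sequent $\phi\vdash\chi$ is $\mathsf{BD}$ valid iff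 in every model $|\phi|^+\subseteq|\chi|^+$ and $|\chi|^-\subseteq|\phi|^-$. Outer languages: $\mathscr{L}_{\mathsf{MCB}}$: $\alpha::=\mathtt{C}\phi\mid\neg\alpha\mid\alpha\circ\alpha$, $\circ\in\{\wedge,\vee,\rightarrow,\prec\}$; $\mathscr{L}_{\mathsf{NMCB}}$: $\alpha::=\mathtt{C}\phi\mid\neg\alpha\mid\alpha\circ\alpha$, $\circ\in\{\wedge,\vee,\rightharpoonup,\multimap\}$; $\phi\in\mathscr{L}_{\mathsf{BD}}$. Bi-G\"odel operations on $[0,1]$: $\wedge=\min$, $\vee=\max$; $a\rightarrow b=1$ if $a\leq b$, else $b$; $a\prec b=0$ if $a\leq b$, else $a$. An uncertainty measure is $\pi:2^W\to[0,1]$ with $\pi(X)\leq\pi(Y)$ whenever $X\subseteq Y\subseteq W$, and $\pi(W)>\pi(\varnothing)$. An $\mathsf{MCB}$ ($\mathsf{NMCB}$) model is $\langle W,v^+,v^-,\pi,e_1,e_2\rangle$ with $\langle W,v^+,v^-\rangle$ a $\mathsf{BD}$ model, $\pi$ an uncertainty measure on $W$, $e_1(\mathtt{C}\phi)=\pi(|\phi|^+)$, $e_2(\mathtt{C}\phi)=\pi(|\phi|^-)$, where the pair $e=(e_1,e_2)$ is extended to complex formulas of $\mathscr{L}_{\mathsf{MCB}}$ (respectively $\mathscr{L}_{\mathsf{NMCB}}$) by the clauses for the connectives of that language: $e_1(\neg\phi)=e_2(\phi)$, $e_2(\neg\phi)=e_1(\phi)$; $e_1(\phi\wedge\phi')=e_1(\phi)\wedge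 e_1(\phi')$, $e_2(\phi\wedge\phi')=e_2(\phi)\vee e_2(\phi')$; $e_1(\phi\vee\phi')=e_1(\phi)\vee e_1(\phi')$, $e_2(\phi\vee\phi')=e_2(\phi)\wedge e_2(\phi')$; $e_1(\phi\rightarrow\phi')=e_1(\phi)\rightarrow e_1(\phi')$, $e_2(\phi\rightarrow\phi')=e_2(\phi')\prec e_2(\phi)$; $e_1(\phi\prec\phi')=e_1(\phi)\prec e_1(\phi')$, $e_2(\phi\prec\phi')=e_2(\phi')\rightarrow e_2(\phi)$; $e_1(\phi\rightharpoonup\phi')=e_1(\phi)\rightarrow e_1(\phi')$, $e_2(\phi\rightharpoonup\phi')=e_1(\phi)\wedge e_2(\phi')$; $e_1(\phi\multimap\phi')=e_1(\phi)\prec e_1(\phi')$, $e_2(\phi\multimap\phi')=e_2(\phi)\vee e_1(\phi')$. Entailment (over all models): $\Psi\models_{\mathsf{MCB}}\alpha$ iff always $\inf\{e_1(\psi):\psi\in\Psi\}\leq e_1(\alpha)$ and $\sup\{e_2(\psi):\psi\in\Psi\}\geq e_2(\alpha)$; $\Omega\models_{\mathsf{NMCB}}\beta$ iff always $\inf\{e_1(\psi):\psi\in\Omega\}\leq e_1(\beta)$. Abbreviations, with $c$ a fixed atom: $\top:=c\rightarrow c$, $\bot:=c\prec c$, ${\sim}\phi:=\phi\rightarrow\bot$ in the $(\rightarrow,\prec)$ language; $\top:=c\rightharpoonup c$, $\bot:=c\multimap c$, ${\sim}\phi:=\phi\rightharpoonup\bot$ in the $(\rightharpoonup,\multimap)$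 language. $\mathcal{H}\mathsf{biG}$ has the axiom schemas: (1) $(\phi\rightarrow\chi)\rightarrow((\chi\rightarrow\psi)\rightarrow(\phi\rightarrow\psi))$; (2) $\phi\rightarrow(\phi\vee\chi)$; $\chi\rightarrow(\phi\vee\chi)$; $(\phi\rightarrow\psi)\rightarrow((\chi\rightarrow\psi)\rightarrow((\phi\vee\chi)\rightarrow\psi))$; (3) $(\phi\wedge\chi)\rightarrow\phi$; $(\phi\wedge\chi)\rightarrow\chi$; $(\phi\rightarrow\chi)\rightarrow((\phi\rightarrow\psi)\rightarrow(\phi\rightarrow(\chi\wedge\psi)))$; (4) $(\phi\rightarrow(\chi\rightarrow\psi))\rightarrow((\phi\wedge\chi)\rightarrow\psi)$; $((\phi\wedge\chi)\rightarrow\psi)\rightarrow(\phi\rightarrow(\chi\rightarrow\psi))$; (5) $(\phi\rightarrow\chi)\rightarrow({\sim}\chi\rightarrow{\sim}\phi)$; (6) $(\phi\prec\chi)\rightarrow(\top\prec(\phi\rightarrow\chi))$; ${\sim}(\phi\prec\chi)\rightarrow(\phi\rightarrow\chi)$; (7) $\phi\rightarrow(\chi\vee(\phi\prec\chi))$; $((\phi\prec\chi)\prec\psi)\rightarrow(\phi\prec(\chi\vee\psi))$; (8) $(\phi\rightarrow\chi)\vee(\chi\rightarrow\phi)$; $\top\prec((\phi\prec\chi)\wedge(\chi\prec\phi))$; and the rules modus ponens and $\mathrm{nec}$ (from $\vdash\phi$ infer $\vdash{\sim}(\top\prec\phi)$; applied only to formulas proved without assumptions). $\mathcal{H}\mathsf{G}^2(\rightarrow,\prec)$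 is $\mathcal{H}\mathsf{biG}$ plus (with $\leftrightarrow$ the conjunction of both $\rightarrow$) $\neg\neg\phi\leftrightarrow\phi$; $\neg(\phi\wedge\chi)\leftrightarrow(\neg\phi\vee\neg\chi)$; $\neg(\phi\vee\chi)\leftrightarrow(\neg\phi\wedge\neg\chi)$; $\neg(\phi\rightarrow\chi)\leftrightarrow(\neg\chi\prec\neg\phi)$; $\neg(\phi\prec\chi)\leftrightarrow(\neg\chi\rightarrow\neg\phi)$. $\mathcal{H}\mathsf{G}^2(\rightharpoonup,\multimap)$ is $\mathcal{H}\mathsf{biG}$ with $\rightarrow$ replaced by $\rightharpoonup$ and $\prec$ by $\multimap$, plus (with $\rightleftharpoons$ the conjunction of both $\rightharpoonup$) $\neg\neg\phi\rightleftharpoons\phi$; $\neg(\phi\wedge\chi)\rightleftharpoons(\neg\phi\vee\neg\chi)$; $\neg(\phi\vee\chi)\rightleftharpoons(\neg\phi\wedge\neg\chi)$; $\neg(\phi\rightharpoonup\chi)\rightleftharpoons(\phi\wedge\neg\chi)$; $\neg(\phi\multimap\chi)\rightleftharpoons(\neg\phi\vee\chi)$. $\mathcal{H}\mathsf{MCB}$: all theorems and rules of $\mathcal{H}\mathsf{G}^2(\rightarrow,\prec)$ instantiated with $\mathscr{L}_{\mathsf{MCB}}$ formulas, plus $\mathtt{C}\phi\rightarrow\mathtt{C}\chi$ whenever $\phi\vdash\chi$ is $\mathsf{BD}$ valid, and $\mathtt{C}\neg\phi\leftrightarrow\neg\mathtt{C}\phi$. $\mathcal{H}\mathsf{NMCB}$: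 all theorems and rules of $\mathcal{H}\mathsf{G}^2(\rightharpoonup,\multimap)$ instantiated with $\mathscr{L}_{\mathsf{NMCB}}$ formulas, plus $\mathtt{C}\phi\Rightarrow\mathtt{C}\chi$ whenever $\phi\vdash\chi$ is $\mathsf{BD}$ valid, and $\mathtt{C}\neg\phi\Leftrightarrow\neg\mathtt{C}\phi$, where $\alpha\Rightarrow\beta:=(\alpha\rightharpoonup\beta)\wedge(\neg\beta\rightharpoonup\neg\alpha)$ and $\alpha\Leftrightarrow\beta:=(\alpha\Rightarrow\beta)\wedge(\beta\Rightarrow\alpha)$. $\vdash$ denotes existence of a finite derivation.
   Formalization: Both calculi are taken with the additional axiom schema ∼((φ≺χ)∧(χ≺φ)) (with ⇀, ⊸ in the second language), since the printed second schema of (8) is too weak to prove this valid formula and completeness fails without it. *)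

theory Defs
  imports Complex_Main
begin

section \<open>Belnap--Dunn logic\<close>

text \<open>\<open>Prop\<close> is countably infinite and is represented by \<^typ>\<open>nat\<close>.\<close>

type_synonym atm = nat

datatype bd = PVar atm | BNeg bd | BAnd bd bd | BOr bd bd

record 'w bd_model =
  worlds :: "'w set"
  vpos :: "atm \<Rightarrow> 'w set"
  vneg :: "atm \<Rightarrow> 'w set"

definition is_bd_model :: "('w, 'z) bd_model_scheme \<Rightarrow> bool" where
  "is_bd_model M \<longleftrightarrow>
     worlds M \<noteq> {} \<and> (\<forall>p. vpos M p \<subseteq> worlds M \<and> vneg M p \<subseteq> worlds M)"

fun supp_pos :: "('w, 'z) bd_model_scheme \<Rightarrow> 'w \<Rightarrow> bd \<Rightarrow> bool"
  and supp_neg :: "('w, 'z) bd_model_scheme \<Rightarrow> 'w \<Rightarrow> bd \<Rightarrow> bool" where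
  "supp_pos M w (PVar p) \<longleftrightarrow> w \<in> vpos M p"
| "supp_pos M w (BNeg \<phi>) \<longleftrightarrow> supp_neg M w \<phi>"
| "supp_pos M w (BAnd \<phi> \<psi>) \<longleftrightarrow> supp_pos M w \<phi> \<and> supp_pos M w \<psi>"
| "supp_pos M w (BOr \<phi> \<psi>) \<longleftrightarrow> supp_pos M w \<phi> \<or> supp_pos M w \<psi>"
| "supp_neg M w (PVar p) \<longleftrightarrow> w \<in> vneg M p"
| "supp_neg M w (BNeg \<phi>) \<longleftrightarrow> supp_pos M w \<phi>"
| "supp_neg M w (BAnd \<phi> \<psi>) \<longleftrightarrow> supp_neg M w \<phi> \<or> supp_neg M w \<psi>"
| "supp_neg M w (BOr \<phi> \<psi>) \<longleftrightarrow> supp_neg M w \<phi> \<and> supp_neg M w \<psi>"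

definition ext_pos :: "('w, 'z) bd_model_scheme \<Rightarrow> bd \<Rightarrow> 'w set" where
  "ext_pos M \<phi> = {w \<in> worlds M. supp_pos M w \<phi>}"

definition ext_neg :: "('w, 'z) bd_model_scheme \<Rightarrow> bd \<Rightarrow> 'w set" where
  "ext_neg M \<phi> = {w \<in> worlds M. supp_neg M w \<phi>}"

text \<open>
  A HOL constant cannot quantify over all types of worlds.  Validity is therefore relative to a
  type \<^typ>\<open>'w\<close> of which the sets of worlds are arbitrary nonempty subsets; lemma
  \<open>bd_valid_in_cong\<close> shows that the choice of the type does not matter, so that
  \<open>bd_valid\<close> is validity in all models whatsoever.
\<close>

definition bd_valid_in :: "'w itself \<Rightarrow> bd \<Rightarrow> bd \<Rightarrow> bool" where
  "bd_valid_in U \<phi> \<chi> \<longleftrightarrow>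
     (\<forall>M :: 'w bd_model. is_bd_model M \<longrightarrow>
        ext_pos M \<phi> \<subseteq> ext_pos M \<chi> \<and> ext_neg M \<chi> \<subseteq> ext_neg M \<phi>)"

definition bd_valid :: "bd \<Rightarrow> bd \<Rightarrow> bool" where
  "bd_valid = bd_valid_in TYPE(nat)"

lemma bd_valid_in_transfer:
  assumes "bd_valid_in TYPE('w) \<phi> \<chi>"
  shows "bd_valid_in TYPE('v) \<phi> \<chi>"
  unfolding bd_valid_in_def
proof (intro allI impI)
  fix M :: "'v bd_model"
  assume M: "is_bd_model M"
  define N :: "'v \<Rightarrow> 'w bd_model" where
    "N v = \<lparr>worlds = UNIV, vpos = (\<lambda>p. {_. v \<in> vpos M p}), vneg = (\<lambda>p. {_. v \<in> vneg M p})\<rparr>" for v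
  have N: "supp_pos (N v) w \<psi> \<longleftrightarrow> supp_pos M v \<psi>"
       "supp_neg (N v) w \<psi> \<longleftrightarrow> supp_neg M v \<psi>" for v w \<psi>
    by (induction \<psi>) (auto simp: N_def)
  have "is_bd_model (N v)" for v
    by (auto simp: is_bd_model_def N_def)
  then have "ext_pos (N v) \<phi> \<subseteq> ext_pos (N v) \<chi> \<and> ext_neg (N v) \<chi> \<subseteq> ext_neg (N v) \<phi>" for v
    using assms by (simp add: bd_valid_in_def)
  moreover have "w \<in> ext_pos (N v) \<psi> \<longleftrightarrow> supp_pos M v \<psi>"
      "w \<in> ext_neg (N v) \<psi> \<longleftrightarrow> supp_neg M v \<psi>" for v w \<psi>
    by (simp_all add: ext_pos_def ext_neg_def N) (simp_all add: N_def)
  ultimately have "(supp_pos M v \<phi> \<longrightarrow> supp_pos M v \<chi>) \<and> (supp_neg M v \<chi> \<longrightarrow> supp_neg M v \<phi>)" for v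
    by (meson subsetD)
  then show "ext_pos M \<phi> \<subseteq> ext_pos M \<chi> \<and> ext_neg M \<chi> \<subseteq> ext_neg M \<phi>"
    by (auto simp: ext_pos_def ext_neg_def)
qed

lemma bd_valid_in_cong: "bd_valid_in TYPE('w) \<phi> \<chi> \<longleftrightarrow> bd_valid \<phi> \<chi>"
  unfolding bd_valid_def by (blast intro: bd_valid_in_transfer)


section \<open>Axioms of bi-Goedel logic\<close>

text \<open>
  The schemas are parametrised by the connectives, since the calculus is used once with
  \<open>\<rightarrow>, \<prec>\<close> and once with \<open>\<rightharpoonup>, \<multimap>\<close>.  The parameter \<open>c\<close> is the formula used in the
  abbreviations \<open>\<top>\<close>, \<open>\<bottom>\<close> and \<open>\<sim>\<close>.
\<close>

locale biG_signature =
  fixes conj :: "'f \<Rightarrow> 'f \<Rightarrow> 'f" (infixr "\<^bold>\<and>" 75)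
    and disj :: "'f \<Rightarrow> 'f \<Rightarrow> 'f" (infixr "\<^bold>\<or>" 70)
    and imp :: "'f \<Rightarrow> 'f \<Rightarrow> 'f" (infixr "\<^bold>\<rightarrow>" 65)
    and coimp :: "'f \<Rightarrow> 'f \<Rightarrow> 'f" (infix "\<^bold>\<prec>" 65)
    and c :: 'f
begin

definition top ("\<^bold>\<top>") where "\<^bold>\<top> = (c \<^bold>\<rightarrow> c)"

definition bot ("\<^bold>\<bottom>") where "\<^bold>\<bottom> = (c \<^bold>\<prec> c)"

definition sim ("\<^bold>\<sim> _" [80] 80) where "\<^bold>\<sim> \<phi> = (\<phi> \<^bold>\<rightarrow> \<^bold>\<bottom>)"

definition delta where "delta \<phi> = \<^bold>\<sim> (\<^bold>\<top> \<^bold>\<prec> \<phi>)"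

inductive axiom :: "'f \<Rightarrow> bool" where
  trans: "axiom ((\<phi> \<^bold>\<rightarrow> \<chi>) \<^bold>\<rightarrow> ((\<chi> \<^bold>\<rightarrow> \<psi>) \<^bold>\<rightarrow> (\<phi> \<^bold>\<rightarrow> \<psi>)))"
| disjI1: "axiom (\<phi> \<^bold>\<rightarrow> (\<phi> \<^bold>\<or> \<chi>))"
| disjI2: "axiom (\<chi> \<^bold>\<rightarrow> (\<phi> \<^bold>\<or> \<chi>))"
| disjE: "axiom ((\<phi> \<^bold>\<rightarrow> \<psi>) \<^bold>\<rightarrow> ((\<chi> \<^bold>\<rightarrow> \<psi>) \<^bold>\<rightarrow> ((\<phi> \<^bold>\<or> \<chi>) \<^bold>\<rightarrow> \<psi>)))"
| conjE1: "axiom ((\<phi> \<^bold>\<and> \<chi>) \<^bold>\<rightarrow> \<phi>)"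
| conjE2: "axiom ((\<phi> \<^bold>\<and> \<chi>) \<^bold>\<rightarrow> \<chi>)"
| conjI: "axiom ((\<phi> \<^bold>\<rightarrow> \<chi>) \<^bold>\<rightarrow> ((\<phi> \<^bold>\<rightarrow> \<psi>) \<^bold>\<rightarrow> (\<phi> \<^bold>\<rightarrow> (\<chi> \<^bold>\<and> \<psi>))))"
| import: "axiom ((\<phi> \<^bold>\<rightarrow> (\<chi> \<^bold>\<rightarrow> \<psi>)) \<^bold>\<rightarrow> ((\<phi> \<^bold>\<and> \<chi>) \<^bold>\<rightarrow> \<psi>))"
| export: "axiom (((\<phi> \<^bold>\<and> \<chi>) \<^bold>\<rightarrow> \<psi>) \<^bold>\<rightarrow> (\<phi> \<^bold>\<rightarrow> (\<chi> \<^bold>\<rightarrow> \<psi>)))"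
| contrapos: "axiom ((\<phi> \<^bold>\<rightarrow> \<chi>) \<^bold>\<rightarrow> (\<^bold>\<sim> \<chi> \<^bold>\<rightarrow> \<^bold>\<sim> \<phi>))"
| coimp_top: "axiom ((\<phi> \<^bold>\<prec> \<chi>) \<^bold>\<rightarrow> (\<^bold>\<top> \<^bold>\<prec> (\<phi> \<^bold>\<rightarrow> \<chi>)))"
| sim_coimp: "axiom (\<^bold>\<sim> (\<phi> \<^bold>\<prec> \<chi>) \<^bold>\<rightarrow> (\<phi> \<^bold>\<rightarrow> \<chi>))"
| coimp_disj: "axiom (\<phi> \<^bold>\<rightarrow> (\<chi> \<^bold>\<or> (\<phi> \<^bold>\<prec> \<chi>)))"
| coimp_coimp: "axiom (((\<phi> \<^bold>\<prec> \<chi>) \<^bold>\<prec> \<psi>) \<^bold>\<rightarrow> (\<phi> \<^bold>\<prec> (\<chi> \<^bold>\<or> \<psi>)))"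
| linear: "axiom ((\<phi> \<^bold>\<rightarrow> \<chi>) \<^bold>\<or> (\<chi> \<^bold>\<rightarrow> \<phi>))"
| top_colinear: "axiom (\<^bold>\<top> \<^bold>\<prec> ((\<phi> \<^bold>\<prec> \<chi>) \<^bold>\<and> (\<chi> \<^bold>\<prec> \<phi>)))"

text \<open>
  The predicate \<open>axiom\<close> contains the schemas exactly as they are printed in the source.  Its last
  schema, intended as dual prelinearity, is too weak: together with modus ponens and nec the
  printed schemas do not prove \<open>\<sim>((\<phi> \<prec> \<chi>) \<and> (\<chi> \<prec> \<phi>))\<close>, which is valid on \<open>[0,1]\<close> (see
  \<open>printed_schemas_incomplete\<close> below), so that no completeness theorem can hold for them.  The calculi
  below use \<open>biG_axiom\<close>, which adds this one schema to the printed ones.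
\<close>

inductive biG_axiom :: "'f \<Rightarrow> bool" where
  printed: "axiom \<phi> \<Longrightarrow> biG_axiom \<phi>"
| colinear: "biG_axiom (\<^bold>\<sim> ((\<phi> \<^bold>\<prec> \<chi>) \<^bold>\<and> (\<chi> \<^bold>\<prec> \<phi>)))"

end

text \<open>
  The algebra of up-sets of the poset with exactly the relations \<open>y < x\<close> and \<open>z < x\<close>
  refutes the additional schema: all printed schemas take the top value \<open>A_xyz\<close>, and modus ponens
  and nec preserve this value.
\<close>

datatype upset = A_0 | A_x | A_xy | A_xz | A_xyz

fun up_le :: "upset \<Rightarrow> upset \<Rightarrow> bool" where
  "up_le A_0 _ = True"
| "up_le _ A_xyz = True"
| "up_le A_x b = (b \<noteq> A_0)"
| "up_le a b = (a = b)"

fun up_meet :: "upset \<Rightarrow> upset \<Rightarrow> upset" where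
  "up_meet a b = (if up_le a b then a else if up_le b a then b else A_x)"

fun up_join :: "upset \<Rightarrow> upset \<Rightarrow> upset" where
  "up_join a b = (if up_le a b then b else if up_le b a then a else A_xyz)"

fun up_imp :: "upset \<Rightarrow> upset \<Rightarrow> upset" where
  "up_imp a b = (if up_le a b then A_xyz else if a = A_xy \<and> b \<noteq> A_0 then A_xz
                 else if a = A_xz \<and> b \<noteq> A_0 then A_xy else b)"

fun up_coimp :: "upset \<Rightarrow> upset \<Rightarrow> upset" where
  "up_coimp a b = (if up_le a b then A_0 else if b = A_xy then A_xz
                   else if b = A_xz then A_xy else a)"

lemma up_bot: "biG_signature.bot up_coimp c = A_0"
  unfolding biG_signature.bot_def by (cases c) simp_all

lemma up_top: "biG_signature.top up_imp c = A_xyz"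
  unfolding biG_signature.top_def by (cases c) simp_all

lemma up_axiom:
  assumes "biG_signature.axiom up_meet up_join up_imp up_coimp c a"
  shows "a = A_xyz"
proof -
  interpret biG_signature up_meet up_join up_imp up_coimp c .
  show ?thesis
    using assms
  proof (induction rule: axiom.induct)
    case (trans \<phi> \<chi> \<psi>)
    show ?case by (cases \<phi>; cases \<chi>; cases \<psi>; simp)
  next
    case (disjI1 \<phi> \<chi>)
    show ?case by (cases \<phi>; cases \<chi>; simp)
  next
    case (disjI2 \<chi> \<phi>)
    show ?case by (cases \<phi>; cases \<chi>; simp)
  next
    case (disjE \<phi> \<psi> \<chi>)
    show ?case by (cases \<phi>; cases \<chi>; cases \<psi>; simp)
  next
    case (conjE1 \<phi> \<chi>)
    show ?case by (cases \<phi>; cases \<chi>; simp)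
  next
    case (conjE2 \<phi> \<chi>)
    show ?case by (cases \<phi>; cases \<chi>; simp)
  next
    case (conjI \<phi> \<chi> \<psi>)
    show ?case by (cases \<phi>; cases \<chi>; cases \<psi>; simp)
  next
    case (import \<phi> \<chi> \<psi>)
    show ?case by (cases \<phi>; cases \<chi>; cases \<psi>; simp)
  next
    case (export \<phi> \<chi> \<psi>)
    show ?case by (cases \<phi>; cases \<chi>; cases \<psi>; simp)
  next
    case (contrapos \<phi> \<chi>)
    show ?case by (cases \<phi>; cases \<chi>; simp add: biG_signature.sim_def up_bot)
  next
    case (coimp_top \<phi> \<chi>)
    show ?case by (cases \<phi>; cases \<chi>; simp add: up_top)
  next
    case (sim_coimp \<phi> \<chi>)
    show ?case by (cases \<phi>; cases \<chi>; simp add: biG_signature.sim_def up_bot)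
  next
    case (coimp_disj \<phi> \<chi>)
    show ?case by (cases \<phi>; cases \<chi>; simp)
  next
    case (coimp_coimp \<phi> \<chi> \<psi>)
    show ?case by (cases \<phi>; cases \<chi>; cases \<psi>; simp)
  next
    case (linear \<phi> \<chi>)
    show ?case by (cases \<phi>; cases \<chi>; simp)
  next
    case (top_colinear \<phi> \<chi>)
    show ?case by (cases \<phi>; cases \<chi>; simp add: up_top)
  qed
qed

lemma printed_schemas_incomplete:
  shows "biG_signature.axiom up_meet up_join up_imp up_coimp c a \<Longrightarrow> a = A_xyz"
    and "up_imp A_xyz b = A_xyz \<Longrightarrow> b = A_xyz"
    and "biG_signature.delta up_imp up_coimp c A_xyz = A_xyz"
    and "biG_signature.sim up_imp up_coimp c
           (up_meet (up_coimp A_xy A_xz) (up_coimp A_xz A_xy)) \<noteq> A_xyz"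
proof -
  show "up_imp A_xyz b = A_xyz \<Longrightarrow> b = A_xyz"
    by (cases b) simp_all
qed (simp_all add: up_axiom biG_signature.delta_def biG_signature.sim_def up_bot up_top)


section \<open>The calculi for \<open>G\<^sup>2\<close>\<close>

datatype 'a g2 =
    Atom 'a
  | Neg "'a g2"
  | And "'a g2" "'a g2"
  | Or "'a g2" "'a g2"
  | Imp "'a g2" "'a g2"
  | Coimp "'a g2" "'a g2"

datatype 'a n2 =
    NAtom 'a
  | NNeg "'a n2"
  | NAnd "'a n2" "'a n2"
  | NOr "'a n2" "'a n2"
  | NImp "'a n2" "'a n2"
  | NCoimp "'a n2" "'a n2"

primrec g2_subst :: "('a \<Rightarrow> 'b g2) \<Rightarrow> 'a g2 \<Rightarrow> 'b g2" where
  "g2_subst \<sigma> (Atom a) = \<sigma> a"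
| "g2_subst \<sigma> (Neg \<phi>) = Neg (g2_subst \<sigma> \<phi>)"
| "g2_subst \<sigma> (And \<phi> \<chi>) = And (g2_subst \<sigma> \<phi>) (g2_subst \<sigma> \<chi>)"
| "g2_subst \<sigma> (Or \<phi> \<chi>) = Or (g2_subst \<sigma> \<phi>) (g2_subst \<sigma> \<chi>)"
| "g2_subst \<sigma> (Imp \<phi> \<chi>) = Imp (g2_subst \<sigma> \<phi>) (g2_subst \<sigma> \<chi>)"
| "g2_subst \<sigma> (Coimp \<phi> \<chi>) = Coimp (g2_subst \<sigma> \<phi>) (g2_subst \<sigma> \<chi>)"

primrec n2_subst :: "('a \<Rightarrow> 'b n2) \<Rightarrow> 'a n2 \<Rightarrow> 'b n2" where
  "n2_subst \<sigma> (NAtom a) = \<sigma> a"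
| "n2_subst \<sigma> (NNeg \<phi>) = NNeg (n2_subst \<sigma> \<phi>)"
| "n2_subst \<sigma> (NAnd \<phi> \<chi>) = NAnd (n2_subst \<sigma> \<phi>) (n2_subst \<sigma> \<chi>)"
| "n2_subst \<sigma> (NOr \<phi> \<chi>) = NOr (n2_subst \<sigma> \<phi>) (n2_subst \<sigma> \<chi>)"
| "n2_subst \<sigma> (NImp \<phi> \<chi>) = NImp (n2_subst \<sigma> \<phi>) (n2_subst \<sigma> \<chi>)"
| "n2_subst \<sigma> (NCoimp \<phi> \<chi>) = NCoimp (n2_subst \<sigma> \<phi>) (n2_subst \<sigma> \<chi>)"

abbreviation Iff :: "'a g2 \<Rightarrow> 'a g2 \<Rightarrow> 'a g2" where
  "Iff \<phi> \<chi> \<equiv> And (Imp \<phi> \<chi>) (Imp \<chi> \<phi>)"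

abbreviation NIff :: "'a n2 \<Rightarrow> 'a n2 \<Rightarrow> 'a n2" where
  "NIff \<phi> \<chi> \<equiv> NAnd (NImp \<phi> \<chi>) (NImp \<chi> \<phi>)"

abbreviation g2_axiom :: "'a g2 \<Rightarrow> 'a g2 \<Rightarrow> bool" where
  "g2_axiom c \<equiv> biG_signature.biG_axiom And Or Imp Coimp c"

abbreviation n2_axiom :: "'a n2 \<Rightarrow> 'a n2 \<Rightarrow> bool" where
  "n2_axiom c \<equiv> biG_signature.biG_axiom NAnd NOr NImp NCoimp c"

abbreviation g2_delta :: "'a g2 \<Rightarrow> 'a g2 \<Rightarrow> 'a g2" where
  "g2_delta c \<equiv> biG_signature.delta Imp Coimp c"

abbreviation n2_delta :: "'a n2 \<Rightarrow> 'a n2 \<Rightarrow> 'a n2" where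
  "n2_delta c \<equiv> biG_signature.delta NImp NCoimp c"

text \<open>The fixed atom \<open>c\<close> of the abbreviations is the atom \<open>0\<close>.\<close>

inductive g2_thm :: "atm g2 \<Rightarrow> bool" where
  biG: "g2_axiom (Atom 0) \<phi> \<Longrightarrow> g2_thm \<phi>"
| neg_neg: "g2_thm (Iff (Neg (Neg \<phi>)) \<phi>)"
| neg_and: "g2_thm (Iff (Neg (And \<phi> \<chi>)) (Or (Neg \<phi>) (Neg \<chi>)))"
| neg_or: "g2_thm (Iff (Neg (Or \<phi> \<chi>)) (And (Neg \<phi>) (Neg \<chi>)))"
| neg_imp: "g2_thm (Iff (Neg (Imp \<phi> \<chi>)) (Coimp (Neg \<chi>) (Neg \<phi>)))"
| neg_coimp: "g2_thm (Iff (Neg (Coimp \<phi> \<chi>)) (Imp (Neg \<chi>) (Neg \<phi>)))"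
| mp: "g2_thm \<phi> \<Longrightarrow> g2_thm (Imp \<phi> \<chi>) \<Longrightarrow> g2_thm \<chi>"
| nec: "g2_thm \<phi> \<Longrightarrow> g2_thm (g2_delta (Atom 0) \<phi>)"

inductive n2_thm :: "atm n2 \<Rightarrow> bool" where
  biG: "n2_axiom (NAtom 0) \<phi> \<Longrightarrow> n2_thm \<phi>"
| neg_neg: "n2_thm (NIff (NNeg (NNeg \<phi>)) \<phi>)"
| neg_and: "n2_thm (NIff (NNeg (NAnd \<phi> \<chi>)) (NOr (NNeg \<phi>) (NNeg \<chi>)))"
| neg_or: "n2_thm (NIff (NNeg (NOr \<phi> \<chi>)) (NAnd (NNeg \<phi>) (NNeg \<chi>)))"
| neg_imp: "n2_thm (NIff (NNeg (NImp \<phi> \<chi>)) (NAnd \<phi> (NNeg \<chi>)))"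
| neg_coimp: "n2_thm (NIff (NNeg (NCoimp \<phi> \<chi>)) (NOr (NNeg \<phi>) \<chi>))"
| mp: "n2_thm \<phi> \<Longrightarrow> n2_thm (NImp \<phi> \<chi>) \<Longrightarrow> n2_thm \<chi>"
| nec: "n2_thm \<phi> \<Longrightarrow> n2_thm (n2_delta (NAtom 0) \<phi>)"


section \<open>The calculi \<open>HMCB\<close> and \<open>HNMCB\<close>\<close>

text \<open>The atoms of the outer languages are the formulas \<open>C \<phi>\<close> with \<open>\<phi>\<close> a Belnap--Dunn formula.\<close>

type_synonym mcb = "bd g2"
type_synonym nmcb = "bd n2"

abbreviation C :: "bd \<Rightarrow> mcb" where "C \<equiv> Atom"
abbreviation NC :: "bd \<Rightarrow> nmcb" where "NC \<equiv> NAtom"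

abbreviation NSImp :: "'a n2 \<Rightarrow> 'a n2 \<Rightarrow> 'a n2" where
  "NSImp \<alpha> \<beta> \<equiv> NAnd (NImp \<alpha> \<beta>) (NImp (NNeg \<beta>) (NNeg \<alpha>))"

abbreviation NSIff :: "'a n2 \<Rightarrow> 'a n2 \<Rightarrow> 'a n2" where
  "NSIff \<alpha> \<beta> \<equiv> NAnd (NSImp \<alpha> \<beta>) (NSImp \<beta> \<alpha>)"

text \<open>
  In the instances of nec the atom \<open>c\<close> hidden in \<open>\<top>\<close> and \<open>\<bottom>\<close> is instantiated as well, by \<open>\<gamma>\<close>.
\<close>

inductive mcb_thm :: "mcb \<Rightarrow> bool" where
  inst: "g2_thm \<phi> \<Longrightarrow> mcb_thm (g2_subst \<sigma> \<phi>)"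
| mono: "bd_valid \<phi> \<chi> \<Longrightarrow> mcb_thm (Imp (C \<phi>) (C \<chi>))"
| neg: "mcb_thm (Iff (C (BNeg \<phi>)) (Neg (C \<phi>)))"
| mp: "mcb_thm \<alpha> \<Longrightarrow> mcb_thm (Imp \<alpha> \<beta>) \<Longrightarrow> mcb_thm \<beta>"
| nec: "mcb_thm \<alpha> \<Longrightarrow> mcb_thm (g2_delta \<gamma> \<alpha>)"

inductive nmcb_thm :: "nmcb \<Rightarrow> bool" where
  inst: "n2_thm \<phi> \<Longrightarrow> nmcb_thm (n2_subst \<sigma> \<phi>)"
| mono: "bd_valid \<phi> \<chi> \<Longrightarrow> nmcb_thm (NSImp (NC \<phi>) (NC \<chi>))"
| neg: "nmcb_thm (NSIff (NC (BNeg \<phi>)) (NNeg (NC \<phi>)))"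
| mp: "nmcb_thm \<alpha> \<Longrightarrow> nmcb_thm (NImp \<alpha> \<beta>) \<Longrightarrow> nmcb_thm \<beta>"
| nec: "nmcb_thm \<alpha> \<Longrightarrow> nmcb_thm (n2_delta \<gamma> \<alpha>)"

inductive mcb_derives :: "mcb set \<Rightarrow> mcb \<Rightarrow> bool" for \<Psi> :: "mcb set" where
  assm: "\<alpha> \<in> \<Psi> \<Longrightarrow> mcb_derives \<Psi> \<alpha>"
| logical: "mcb_thm \<alpha> \<Longrightarrow> mcb_derives \<Psi> \<alpha>"
| mp: "mcb_derives \<Psi> \<alpha> \<Longrightarrow> mcb_derives \<Psi> (Imp \<alpha> \<beta>) \<Longrightarrow> mcb_derives \<Psi> \<beta>"

inductive nmcb_derives :: "nmcb set \<Rightarrow> nmcb \<Rightarrow> bool" for \<Omega> :: "nmcb set" where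
  assm: "\<alpha> \<in> \<Omega> \<Longrightarrow> nmcb_derives \<Omega> \<alpha>"
| logical: "nmcb_thm \<alpha> \<Longrightarrow> nmcb_derives \<Omega> \<alpha>"
| mp: "nmcb_derives \<Omega> \<alpha> \<Longrightarrow> nmcb_derives \<Omega> (NImp \<alpha> \<beta>) \<Longrightarrow> nmcb_derives \<Omega> \<beta>"


section \<open>Semantics\<close>

definition biG_imp :: "real \<Rightarrow> real \<Rightarrow> real" where
  "biG_imp a b = (if a \<le> b then 1 else b)"

definition biG_coimp :: "real \<Rightarrow> real \<Rightarrow> real" where
  "biG_coimp a b = (if a \<le> b then 0 else a)"

text \<open>\<open>f1\<close> and \<open>f2\<close> are the values of \<open>e\<^sub>1\<close> and \<open>e\<^sub>2\<close> on atoms.\<close>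

fun g2_e1 g2_e2 :: "('a \<Rightarrow> real) \<Rightarrow> ('a \<Rightarrow> real) \<Rightarrow> 'a g2 \<Rightarrow> real" where
  "g2_e1 f1 f2 (Atom a) = f1 a"
| "g2_e1 f1 f2 (Neg \<phi>) = g2_e2 f1 f2 \<phi>"
| "g2_e1 f1 f2 (And \<phi> \<chi>) = min (g2_e1 f1 f2 \<phi>) (g2_e1 f1 f2 \<chi>)"
| "g2_e1 f1 f2 (Or \<phi> \<chi>) = max (g2_e1 f1 f2 \<phi>) (g2_e1 f1 f2 \<chi>)"
| "g2_e1 f1 f2 (Imp \<phi> \<chi>) = biG_imp (g2_e1 f1 f2 \<phi>) (g2_e1 f1 f2 \<chi>)"
| "g2_e1 f1 f2 (Coimp \<phi> \<chi>) = biG_coimp (g2_e1 f1 f2 \<phi>) (g2_e1 f1 f2 \<chi>)"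
| "g2_e2 f1 f2 (Atom a) = f2 a"
| "g2_e2 f1 f2 (Neg \<phi>) = g2_e1 f1 f2 \<phi>"
| "g2_e2 f1 f2 (And \<phi> \<chi>) = max (g2_e2 f1 f2 \<phi>) (g2_e2 f1 f2 \<chi>)"
| "g2_e2 f1 f2 (Or \<phi> \<chi>) = min (g2_e2 f1 f2 \<phi>) (g2_e2 f1 f2 \<chi>)"
| "g2_e2 f1 f2 (Imp \<phi> \<chi>) = biG_coimp (g2_e2 f1 f2 \<chi>) (g2_e2 f1 f2 \<phi>)"
| "g2_e2 f1 f2 (Coimp \<phi> \<chi>) = biG_imp (g2_e2 f1 f2 \<chi>) (g2_e2 f1 f2 \<phi>)"

fun n2_e1 n2_e2 :: "('a \<Rightarrow> real) \<Rightarrow> ('a \<Rightarrow> real) \<Rightarrow> 'a n2 \<Rightarrow> real" where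
  "n2_e1 f1 f2 (NAtom a) = f1 a"
| "n2_e1 f1 f2 (NNeg \<phi>) = n2_e2 f1 f2 \<phi>"
| "n2_e1 f1 f2 (NAnd \<phi> \<chi>) = min (n2_e1 f1 f2 \<phi>) (n2_e1 f1 f2 \<chi>)"
| "n2_e1 f1 f2 (NOr \<phi> \<chi>) = max (n2_e1 f1 f2 \<phi>) (n2_e1 f1 f2 \<chi>)"
| "n2_e1 f1 f2 (NImp \<phi> \<chi>) = biG_imp (n2_e1 f1 f2 \<phi>) (n2_e1 f1 f2 \<chi>)"
| "n2_e1 f1 f2 (NCoimp \<phi> \<chi>) = biG_coimp (n2_e1 f1 f2 \<phi>) (n2_e1 f1 f2 \<chi>)"
| "n2_e2 f1 f2 (NAtom a) = f2 a"
| "n2_e2 f1 f2 (NNeg \<phi>) = n2_e1 f1 f2 \<phi>"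
| "n2_e2 f1 f2 (NAnd \<phi> \<chi>) = max (n2_e2 f1 f2 \<phi>) (n2_e2 f1 f2 \<chi>)"
| "n2_e2 f1 f2 (NOr \<phi> \<chi>) = min (n2_e2 f1 f2 \<phi>) (n2_e2 f1 f2 \<chi>)"
| "n2_e2 f1 f2 (NImp \<phi> \<chi>) = min (n2_e1 f1 f2 \<phi>) (n2_e2 f1 f2 \<chi>)"
| "n2_e2 f1 f2 (NCoimp \<phi> \<chi>) = max (n2_e2 f1 f2 \<phi>) (n2_e1 f1 f2 \<chi>)"

text \<open>The values of \<open>\<pi>\<close> outside the powerset of \<open>W\<close> are irrelevant.\<close>

definition uncertainty_measure :: "'w set \<Rightarrow> ('w set \<Rightarrow> real) \<Rightarrow> bool" where
  "uncertainty_measure W \<pi> \<longleftrightarrow>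
     (\<forall>X. X \<subseteq> W \<longrightarrow> \<pi> X \<in> {0..1}) \<and>
     (\<forall>X Y. X \<subseteq> Y \<and> Y \<subseteq> W \<longrightarrow> \<pi> X \<le> \<pi> Y) \<and>
     \<pi> W > \<pi> {}"

record 'w cb_model = "'w bd_model" +
  measure :: "'w set \<Rightarrow> real"

definition is_cb_model :: "'w cb_model \<Rightarrow> bool" where
  "is_cb_model M \<longleftrightarrow> is_bd_model M \<and> uncertainty_measure (worlds M) (measure M)"

definition mcb_e1 :: "'w cb_model \<Rightarrow> mcb \<Rightarrow> real" where
  "mcb_e1 M = g2_e1 (\<lambda>\<phi>. measure M (ext_pos M \<phi>)) (\<lambda>\<phi>. measure M (ext_neg M \<phi>))"

definition mcb_e2 :: "'w cb_model \<Rightarrow> mcb \<Rightarrow> real" where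
  "mcb_e2 M = g2_e2 (\<lambda>\<phi>. measure M (ext_pos M \<phi>)) (\<lambda>\<phi>. measure M (ext_neg M \<phi>))"

definition nmcb_e1 :: "'w cb_model \<Rightarrow> nmcb \<Rightarrow> real" where
  "nmcb_e1 M = n2_e1 (\<lambda>\<phi>. measure M (ext_pos M \<phi>)) (\<lambda>\<phi>. measure M (ext_neg M \<phi>))"

text \<open>Infimum and supremum in the lattice \<open>[0,1]\<close>, where \<open>inf \<emptyset> = 1\<close> and \<open>sup \<emptyset> = 0\<close>.\<close>

definition unit_Inf :: "real set \<Rightarrow> real" where
  "unit_Inf A = (if A = {} then 1 else Inf A)"

definition unit_Sup :: "real set \<Rightarrow> real" where
  "unit_Sup A = (if A = {} then 0 else Sup A)"

text \<open>
  Entailment over all models whose set of worlds is a nonempty set of elements of \<^typ>\<open>'w\<close>.  Entailment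
  over all models is entailment for every infinite \<^typ>\<open>'w\<close>, as every set of worlds embeds into an
  infinite type.
\<close>

definition mcb_entails :: "'w itself \<Rightarrow> mcb set \<Rightarrow> mcb \<Rightarrow> bool" where
  "mcb_entails U \<Psi> \<alpha> \<longleftrightarrow>
     (\<forall>M :: 'w cb_model. is_cb_model M \<longrightarrow>
        unit_Inf (mcb_e1 M ` \<Psi>) \<le> mcb_e1 M \<alpha> \<and> unit_Sup (mcb_e2 M ` \<Psi>) \<ge> mcb_e2 M \<alpha>)"

definition nmcb_entails :: "'w itself \<Rightarrow> nmcb set \<Rightarrow> nmcb \<Rightarrow> bool" where
  "nmcb_entails U \<Omega> \<beta> \<longleftrightarrow>
     (\<forall>M :: 'w cb_model. is_cb_model M \<longrightarrow> unit_Inf (nmcb_e1 M ` \<Omega>) \<le> nmcb_e1 M \<beta>)"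

end

theory Submission
  imports Defs "HOL-Library.Countable"
begin

text \<open>
  Soundness is a computation in \<open>[0,1]\<close>: every theorem has the value \<open>1\<close> under \<open>e\<^sub>1\<close>, and the formulas
  whose value is at least \<open>inf e\<^sub>1[\<Psi>]\<close> are closed under modus ponens (lemma \<open>deductive_unit_Inf\<close>).  For
  \<open>MCB\<close> the condition on \<open>e\<^sub>2\<close> is the condition on \<open>e\<^sub>1\<close> in another model: complementing the valuations
  as in \<open>v\<^sup>+ \<mapsto> W - v\<^sup>-\<close> and the measure as in \<open>\<pi>(X) \<mapsto> 1 - \<pi>(W - X)\<close> turns \<open>e\<^sub>2\<close> into \<open>1 - e\<^sub>1\<close>
  (lemma \<open>mcb_e1_dual\<close>).

  For completeness let \<open>\<alpha>\<close> be underivable from \<open>\<Psi>\<close>.  The argument has an algebraic half and a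
  model-theoretic half.

  In the algebraic half (theorem \<open>separating_valuation\<close>), Zorn's lemma extends the consequences of \<open>\<Psi>\<close> to
  a prime deductively closed set \<open>T\<close> without \<open>\<alpha>\<close>.  Since nec may not be applied to assumptions, \<open>T\<close>
  is only a filter of the Lindenbaum algebra, and the preorder \<open>\<phi> \<rightarrow> \<chi> \<in> T\<close> is compatible with
  \<open>\<rightarrow>\<close> but in general not with \<open>\<prec>\<close>.  Therefore formulas are compared by \<open>\<Delta>(\<phi> \<rightarrow> \<chi>) \<in> T\<close>, where
  \<open>\<Delta>\<phi> = \<sim>(\<top> \<prec> \<phi>)\<close>.  The schema \<open>\<sim>((\<phi> \<prec> \<chi>) \<and> (\<chi> \<prec> \<phi>))\<close> makes \<open>\<Delta>\<phi>\<close> complemented,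
  with complement \<open>\<top> \<prec> \<phi>\<close>, and makes \<open>\<Delta>\<close> commute with disjunctions; together with
  \<open>(\<phi> \<rightarrow> \<chi>) \<or> (\<chi> \<rightarrow> \<phi>)\<close> it follows that this comparison is a total preorder whose quotient is
  a countable bi-Goedel chain with \<open>T\<close> as an up-set.  On a chain with least and
  greatest element the bi-Goedel operations are determined by the order; hence every order embedding
  into \<open>[0,1]\<close> that preserves the end points is a valuation.  The embedding is chosen with a gap between
  \<open>T\<close> and its complement, which gives \<open>inf v[\<Psi>] \<ge> 2/3 > 1/3 \<ge> v(\<alpha>)\<close> even for infinite \<open>\<Psi>\<close>.

  In the model-theoretic half (lemma \<open>cb_model_realizing\<close>), the worlds are the finite sets of
  literals, given as pairs of lists of atoms.
  There are countably many of them, so they fit into every infinite type, and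
  \<open>|\<phi>|\<^sup>+ \<subseteq> |\<chi>|\<^sup>+\<close> holds among them exactly if \<open>\<phi> \<turnstile> \<chi>\<close> is valid.  Hence
  \<open>\<pi>(X) = sup {v(C \<phi>) | \<phi>. |\<phi>|\<^sup>+ \<subseteq> X}\<close> (with \<open>\<pi>(W) = 1\<close>) gives
  \<open>\<pi>(|\<phi>|\<^sup>+) = v(C \<phi>)\<close> by the monotonicity axioms.
  The axioms for \<open>\<not>\<close> then identify \<open>e\<^sub>1(\<phi>)\<close> with \<open>v(\<phi>)\<close> and \<open>e\<^sub>2(\<phi>)\<close> with \<open>v(\<not>\<phi>)\<close>.
\<close>

section \<open>Valuations in \<open>[0,1]\<close>\<close>

context biG_signature
begin

definition valuation :: "('f \<Rightarrow> real) \<Rightarrow> bool" where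
  "valuation e \<longleftrightarrow>
     (\<forall>\<phi>. 0 \<le> e \<phi> \<and> e \<phi> \<le> 1) \<and>
     (\<forall>\<phi> \<chi>. e (\<phi> \<^bold>\<and> \<chi>) = min (e \<phi>) (e \<chi>) \<and> e (\<phi> \<^bold>\<or> \<chi>) = max (e \<phi>) (e \<chi>) \<and>
            e (\<phi> \<^bold>\<rightarrow> \<chi>) = biG_imp (e \<phi>) (e \<chi>) \<and> e (\<phi> \<^bold>\<prec> \<chi>) = biG_coimp (e \<phi>) (e \<chi>))"

text \<open>
  The deductively closed sets of a calculus whose derivations from assumptions use its theorems and modus
  ponens; derivability from \<open>\<Psi>\<close> is membership in all of them that include \<open>\<Psi>\<close>.
\<close>

definition deductive :: "('f \<Rightarrow> bool) \<Rightarrow> 'f set \<Rightarrow> bool" where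
  "deductive thms D \<longleftrightarrow>
     (\<forall>\<phi>. thms \<phi> \<longrightarrow> \<phi> \<in> D) \<and> (\<forall>\<phi> \<chi>. \<phi> \<in> D \<longrightarrow> (\<phi> \<^bold>\<rightarrow> \<chi>) \<in> D \<longrightarrow> \<chi> \<in> D)"

context
  fixes e
  assumes e: "valuation e"
begin

lemma valuation_bounds: "0 \<le> e \<phi>" "e \<phi> \<le> 1"
  using e by (auto simp: valuation_def)

lemma valuation_simps:
  "e (\<phi> \<^bold>\<and> \<chi>) = min (e \<phi>) (e \<chi>)" "e (\<phi> \<^bold>\<or> \<chi>) = max (e \<phi>) (e \<chi>)"
  "e (\<phi> \<^bold>\<rightarrow> \<chi>) = biG_imp (e \<phi>) (e \<chi>)" "e (\<phi> \<^bold>\<prec> \<chi>) = biG_coimp (e \<phi>) (e \<chi>)"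
  "e \<^bold>\<top> = 1" "e \<^bold>\<bottom> = 0"
  using e by (auto simp: valuation_def top_def bot_def biG_imp_def biG_coimp_def)

lemma valuation_axiom: "biG_axiom \<phi> \<Longrightarrow> e \<phi> = 1"
proof (induction rule: biG_axiom.induct)
  case (printed \<phi>)
  have *: "0 \<le> e \<chi>" "\<not> 1 < e \<chi>" "\<not> e \<chi> < 0" "e \<chi> \<le> 1"
    "e \<chi> \<le> 0 \<longleftrightarrow> e \<chi> = 0" "1 \<le> e \<chi> \<longleftrightarrow> e \<chi> = 1" for \<chi>
    using valuation_bounds[of \<chi>] by auto
  show ?case
    using printed
    by cases (auto simp: valuation_simps sim_def biG_imp_def biG_coimp_def min_def max_def * 
               dest: order.strict_trans1 simp del: not_less split: if_splits)
next
  case (colinear \<phi> \<chi>)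
  show ?case
    using valuation_bounds[of \<phi>] valuation_bounds[of \<chi>]
    by (auto simp: valuation_simps sim_def biG_imp_def biG_coimp_def)
qed

lemma valuation_delta: "e \<phi> = 1 \<Longrightarrow> e (delta \<phi>) = 1"
  by (simp add: delta_def sim_def valuation_simps biG_imp_def biG_coimp_def)

lemma valuation_mp: "e \<phi> = 1 \<Longrightarrow> e (\<phi> \<^bold>\<rightarrow> \<chi>) = 1 \<Longrightarrow> e \<chi> = 1"
  using valuation_bounds(2)[of \<chi>] by (auto simp: valuation_simps biG_imp_def split: if_splits)

lemma valuation_imp_iff: "e (\<phi> \<^bold>\<rightarrow> \<chi>) = 1 \<longleftrightarrow> e \<phi> \<le> e \<chi>"
  using valuation_bounds(2)[of \<phi>] by (auto simp: valuation_simps biG_imp_def)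

lemma valuation_conj_iff: "e (\<phi> \<^bold>\<and> \<chi>) = 1 \<longleftrightarrow> e \<phi> = 1 \<and> e \<chi> = 1"
  using valuation_bounds(2)[of \<phi>] valuation_bounds(2)[of \<chi>] by (auto simp: valuation_simps)

lemma deductive_unit_Inf:
  assumes "\<And>\<phi>. thms \<phi> \<Longrightarrow> e \<phi> = 1"
  shows "deductive thms {\<phi>. unit_Inf (e ` \<Psi>) \<le> e \<phi>}" "\<Psi> \<subseteq> {\<phi>. unit_Inf (e ` \<Psi>) \<le> e \<phi>}"
proof -
  have bdd: "bdd_below (e ` \<Psi>)"
    using valuation_bounds by (auto intro!: bdd_belowI)
  then show sub: "\<Psi> \<subseteq> {\<phi>. unit_Inf (e ` \<Psi>) \<le> e \<phi>}"
    by (auto simp: unit_Inf_def intro: cInf_lower)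
  have "unit_Inf (e ` \<Psi>) \<le> 1"
  proof (cases "\<Psi> = {}")
    case False
    then obtain \<psi> where "\<psi> \<in> \<Psi>" by blast
    then show ?thesis
      using sub valuation_bounds(2)[of \<psi>] by auto
  qed (simp add: unit_Inf_def)
  then show "deductive thms {\<phi>. unit_Inf (e ` \<Psi>) \<le> e \<phi>}"
    using assms by (auto simp: deductive_def valuation_simps biG_imp_def split: if_splits)
qed

end

text \<open>
  The outer calculi contain instances of theorems over the atoms \<^typ>\<open>nat\<close>.  To see that they contain all
  axioms over the outer language, the formulas substituted for the metavariables of a schema are pulled
  back along a surjective substitution.
\<close>

lemma axiom_surj_image:
  assumes h: "\<And>a b. h (conj' a b) = (h a \<^bold>\<and> h b)" "\<And>a b. h (disj' a b) = (h a \<^bold>\<or> h b)"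
      "\<And>a b. h (imp' a b) = (h a \<^bold>\<rightarrow> h b)" "\<And>a b. h (coimp' a b) = (h a \<^bold>\<prec> h b)" "h c' = c"
    and surj: "surj h"
    and ax: "biG_axiom \<phi>"
  shows "\<exists>\<phi>'. biG_signature.biG_axiom conj' disj' imp' coimp' c' \<phi>' \<and> h \<phi>' = \<phi>"
proof -
  interpret S: biG_signature conj' disj' imp' coimp' c' .
  have hs: "h S.top = \<^bold>\<top>" "h S.bot = \<^bold>\<bottom>" "\<And>a. h (S.sim a) = \<^bold>\<sim> (h a)"
    by (simp_all add: S.top_def top_def S.bot_def bot_def S.sim_def sim_def h)
  define s where "s = inv h"
  have s: "h (s a) = a" for a
    unfolding s_def by (rule surj_f_inv_f[OF surj])
  have "\<exists>\<phi>'. S.axiom \<phi>' \<and> h \<phi>' = \<phi>" if "axiom \<phi>" for \<phi>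
    using that
  proof cases
    case (trans \<phi> \<chi> \<psi>)
    then show ?thesis using S.axiom.trans[of "s \<phi>" "s \<chi>" "s \<psi>"] by (force simp: h hs s)
  next
    case (disjI1 \<phi> \<chi>)
    then show ?thesis using S.axiom.disjI1[of "s \<phi>" "s \<chi>"] by (force simp: h hs s)
  next
    case (disjI2 \<chi> \<phi>)
    then show ?thesis using S.axiom.disjI2[of "s \<chi>" "s \<phi>"] by (force simp: h hs s)
  next
    case (disjE \<phi> \<psi> \<chi>)
    then show ?thesis using S.axiom.disjE[of "s \<phi>" "s \<psi>" "s \<chi>"] by (force simp: h hs s)
  next
    case (conjE1 \<phi> \<chi>)
    then show ?thesis using S.axiom.conjE1[of "s \<phi>" "s \<chi>"] by (force simp: h hs s)
  next
    case (conjE2 \<phi> \<chi>)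
    then show ?thesis using S.axiom.conjE2[of "s \<phi>" "s \<chi>"] by (force simp: h hs s)
  next
    case (conjI \<phi> \<chi> \<psi>)
    then show ?thesis using S.axiom.conjI[of "s \<phi>" "s \<chi>" "s \<psi>"] by (force simp: h hs s)
  next
    case (import \<phi> \<chi> \<psi>)
    then show ?thesis using S.axiom.import[of "s \<phi>" "s \<chi>" "s \<psi>"] by (force simp: h hs s)
  next
    case (export \<phi> \<chi> \<psi>)
    then show ?thesis using S.axiom.export[of "s \<phi>" "s \<chi>" "s \<psi>"] by (force simp: h hs s)
  next
    case (contrapos \<phi> \<chi>)
    then show ?thesis using S.axiom.contrapos[of "s \<phi>" "s \<chi>"] by (force simp: h hs s)
  next
    case (coimp_top \<phi> \<chi>)
    then show ?thesis using S.axiom.coimp_top[of "s \<phi>" "s \<chi>"] by (force simp: h hs s)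
  next
    case (sim_coimp \<phi> \<chi>)
    then show ?thesis using S.axiom.sim_coimp[of "s \<phi>" "s \<chi>"] by (force simp: h hs s)
  next
    case (coimp_disj \<phi> \<chi>)
    then show ?thesis using S.axiom.coimp_disj[of "s \<phi>" "s \<chi>"] by (force simp: h hs s)
  next
    case (coimp_coimp \<phi> \<chi> \<psi>)
    then show ?thesis using S.axiom.coimp_coimp[of "s \<phi>" "s \<chi>" "s \<psi>"] by (force simp: h hs s)
  next
    case (linear \<phi> \<chi>)
    then show ?thesis using S.axiom.linear[of "s \<phi>" "s \<chi>"] by (force simp: h hs s)
  next
    case (top_colinear \<phi> \<chi>)
    then show ?thesis using S.axiom.top_colinear[of "s \<phi>" "s \<chi>"] by (force simp: h hs s)
  qed
  with ax show ?thesis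
  proof cases
    case (colinear \<phi> \<chi>)
    then show ?thesis using S.biG_axiom.colinear[of "s \<phi>" "s \<chi>"] by (force simp: h hs s)
  qed (use \<open>\<And>\<phi>. axiom \<phi> \<Longrightarrow> \<exists>\<phi>'. S.axiom \<phi>' \<and> h \<phi>' = \<phi>\<close> in \<open>blast intro: S.biG_axiom.printed\<close>)
qed

end

section \<open>The Lindenbaum preorder\<close>

text \<open>
  The parameter \<open>prov\<close> is the set of theorems of any calculus that extends bi-Goedel logic, possibly with
  further connectives and axioms.  The preorder \<open>\<sqsubseteq>\<close> below makes the formulas a bi-Heyting algebra
  up to equivalence; after the residuation laws \<open>leq_imp_iff\<close> and \<open>coimp_leq_iff\<close> the reasoning is
  order-theoretic.
\<close>

locale biG_logic = biG_signature +
  fixes prov :: "'a \<Rightarrow> bool"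
  assumes prov_axiom: "biG_axiom \<phi> \<Longrightarrow> prov \<phi>"
    and prov_mp: "prov \<phi> \<Longrightarrow> prov (\<phi> \<^bold>\<rightarrow> \<chi>) \<Longrightarrow> prov \<chi>"
    and prov_nec: "prov \<phi> \<Longrightarrow> prov (delta \<phi>)"
begin

definition leq (infix "\<sqsubseteq>" 50) where "\<phi> \<sqsubseteq> \<chi> \<longleftrightarrow> prov (\<phi> \<^bold>\<rightarrow> \<chi>)"

lemmas ax = axiom.intros[THEN biG_axiom.printed, THEN prov_axiom]

lemma leq_trans [trans]: "\<phi> \<sqsubseteq> \<chi> \<Longrightarrow> \<chi> \<sqsubseteq> \<psi> \<Longrightarrow> \<phi> \<sqsubseteq> \<psi>"
  unfolding leq_def by (meson ax(1) prov_mp)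

lemma leq_mp: "\<phi> \<sqsubseteq> \<chi> \<Longrightarrow> prov \<phi> \<Longrightarrow> prov \<chi>"
  unfolding leq_def by (rule prov_mp)

lemma conj_leq1: "\<phi> \<^bold>\<and> \<chi> \<sqsubseteq> \<phi>" and conj_leq2: "\<phi> \<^bold>\<and> \<chi> \<sqsubseteq> \<chi>"
  unfolding leq_def by (rule ax)+

lemma leq_conj: "\<phi> \<sqsubseteq> \<chi> \<Longrightarrow> \<phi> \<sqsubseteq> \<psi> \<Longrightarrow> \<phi> \<sqsubseteq> \<chi> \<^bold>\<and> \<psi>"
  unfolding leq_def by (meson ax(7) prov_mp)

lemma leq_disj1: "\<phi> \<sqsubseteq> \<phi> \<^bold>\<or> \<chi>" and leq_disj2: "\<chi> \<sqsubseteq> \<phi> \<^bold>\<or> \<chi>"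
  unfolding leq_def by (rule ax)+

lemma disj_leq: "\<phi> \<sqsubseteq> \<psi> \<Longrightarrow> \<chi> \<sqsubseteq> \<psi> \<Longrightarrow> \<phi> \<^bold>\<or> \<chi> \<sqsubseteq> \<psi>"
  unfolding leq_def by (meson ax(4) prov_mp)

lemma leq_imp_iff: "\<phi> \<sqsubseteq> \<chi> \<^bold>\<rightarrow> \<psi> \<longleftrightarrow> \<phi> \<^bold>\<and> \<chi> \<sqsubseteq> \<psi>"
  unfolding leq_def by (meson ax(8,9) prov_mp)

text \<open>
  Reflexivity is not a schema.  The formula \<open>\<chi> \<rightarrow> (\<phi> \<rightarrow> \<phi>)\<close> is obtained by exporting
  \<open>\<chi> \<and> \<phi> \<rightarrow> \<phi>\<close>, and any theorem may be taken for \<open>\<chi>\<close>.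
\<close>

lemma leq_refl: "\<phi> \<sqsubseteq> \<phi>"
proof -
  have "\<chi> \<sqsubseteq> \<phi> \<^bold>\<rightarrow> \<phi>" for \<chi>
    unfolding leq_imp_iff by (rule conj_leq2)
  then show ?thesis
    unfolding leq_def by (meson ax(1) prov_mp)
qed

lemma leq_prov: "prov \<chi> \<Longrightarrow> \<phi> \<sqsubseteq> \<chi>"
  using conj_leq1[of \<chi> \<phi>] by (metis leq_imp_iff leq_def prov_mp)

lemma prov_top: "prov \<^bold>\<top>"
  using leq_refl by (simp add: top_def leq_def)

lemma leq_coimp_disj: "\<phi> \<sqsubseteq> \<chi> \<^bold>\<or> (\<phi> \<^bold>\<prec> \<chi>)"
  unfolding leq_def by (rule ax)

text \<open>
  Residuation for \<open>\<prec>\<close> is where nec is needed: a theorem \<open>\<theta> = \<phi> \<rightarrow> (\<chi> \<or> \<psi>)\<close> gives \<open>\<sim>(\<top> \<prec> \<theta>)\<close>,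
  and \<open>(\<phi> \<prec> \<chi>) \<prec> \<psi>\<close> lies below \<open>\<top> \<prec> \<theta>\<close>; hence \<open>\<sim>((\<phi> \<prec> \<chi>) \<prec> \<psi>)\<close>, which yields
  \<open>(\<phi> \<prec> \<chi>) \<rightarrow> \<psi>\<close>.
\<close>

lemma coimp_leq_iff: "\<phi> \<^bold>\<prec> \<chi> \<sqsubseteq> \<psi> \<longleftrightarrow> \<phi> \<sqsubseteq> \<chi> \<^bold>\<or> \<psi>"
proof
  assume "\<phi> \<^bold>\<prec> \<chi> \<sqsubseteq> \<psi>"
  then have "\<chi> \<^bold>\<or> (\<phi> \<^bold>\<prec> \<chi>) \<sqsubseteq> \<chi> \<^bold>\<or> \<psi>"
    by (meson disj_leq leq_disj1 leq_disj2 leq_trans)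
  then show "\<phi> \<sqsubseteq> \<chi> \<^bold>\<or> \<psi>"
    using leq_coimp_disj leq_trans by blast
next
  assume "\<phi> \<sqsubseteq> \<chi> \<^bold>\<or> \<psi>"
  then have "prov (\<^bold>\<sim> (\<^bold>\<top> \<^bold>\<prec> (\<phi> \<^bold>\<rightarrow> (\<chi> \<^bold>\<or> \<psi>))))"
    unfolding leq_def by (drule_tac prov_nec) (simp add: delta_def)
  moreover have "(\<phi> \<^bold>\<prec> \<chi>) \<^bold>\<prec> \<psi> \<sqsubseteq> \<^bold>\<top> \<^bold>\<prec> (\<phi> \<^bold>\<rightarrow> (\<chi> \<^bold>\<or> \<psi>))"
    by (rule leq_trans[of _ "\<phi> \<^bold>\<prec> (\<chi> \<^bold>\<or> \<psi>)"]) (unfold leq_def, rule ax, rule ax)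
  ultimately have "prov (\<^bold>\<sim> ((\<phi> \<^bold>\<prec> \<chi>) \<^bold>\<prec> \<psi>))"
    unfolding leq_def by (meson ax(10) prov_mp)
  then show "\<phi> \<^bold>\<prec> \<chi> \<sqsubseteq> \<psi>"
    unfolding leq_def by (meson ax(12) prov_mp)
qed

lemma bot_leq: "\<^bold>\<bottom> \<sqsubseteq> \<phi>"
  unfolding bot_def coimp_leq_iff by (rule leq_disj1)

lemma leq_bot: "\<phi> \<sqsubseteq> \<^bold>\<bottom> \<Longrightarrow> \<phi> \<sqsubseteq> \<psi>"
  by (rule leq_trans[OF _ bot_leq])

lemma conj_leqI1: "\<phi> \<sqsubseteq> \<psi> \<Longrightarrow> \<phi> \<^bold>\<and> \<chi> \<sqsubseteq> \<psi>" and conj_leqI2: "\<chi> \<sqsubseteq> \<psi> \<Longrightarrow> \<phi> \<^bold>\<and> \<chi> \<sqsubseteq> \<psi>"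
  by (rule leq_trans[OF conj_leq1] leq_trans[OF conj_leq2], assumption)+

lemma leq_disjI1: "\<psi> \<sqsubseteq> \<phi> \<Longrightarrow> \<psi> \<sqsubseteq> \<phi> \<^bold>\<or> \<chi>" and leq_disjI2: "\<psi> \<sqsubseteq> \<chi> \<Longrightarrow> \<psi> \<sqsubseteq> \<phi> \<^bold>\<or> \<chi>"
  by (rule leq_trans[OF _ leq_disj1] leq_trans[OF _ leq_disj2], assumption)+

lemma conj_mono: "\<phi> \<sqsubseteq> \<phi>' \<Longrightarrow> \<chi> \<sqsubseteq> \<chi>' \<Longrightarrow> \<phi> \<^bold>\<and> \<chi> \<sqsubseteq> \<phi>' \<^bold>\<and> \<chi>'"
  by (intro leq_conj) (rule conj_leqI1 conj_leqI2, assumption)+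

lemma disj_mono: "\<phi> \<sqsubseteq> \<phi>' \<Longrightarrow> \<chi> \<sqsubseteq> \<chi>' \<Longrightarrow> \<phi> \<^bold>\<or> \<chi> \<sqsubseteq> \<phi>' \<^bold>\<or> \<chi>'"
  by (intro disj_leq) (rule leq_disjI1 leq_disjI2, assumption)+

lemma conj_commute: "\<phi> \<^bold>\<and> \<chi> \<sqsubseteq> \<chi> \<^bold>\<and> \<phi>"
  by (intro leq_conj conj_leq1 conj_leq2)

lemma disj_commute: "\<phi> \<^bold>\<or> \<chi> \<sqsubseteq> \<chi> \<^bold>\<or> \<phi>"
  by (intro disj_leq leq_disj1 leq_disj2)

lemma imp_elim: "(\<phi> \<^bold>\<rightarrow> \<chi>) \<^bold>\<and> \<phi> \<sqsubseteq> \<chi>"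
  using leq_refl leq_imp_iff by blast

text \<open>
  The two distributive laws come from residuation: \<open>\<theta> \<and> _\<close> has a right adjoint and \<open>\<psi> \<or> _\<close> has a
  left adjoint.
\<close>

lemma conj_disj_leq:
  assumes "\<theta> \<^bold>\<and> \<phi> \<sqsubseteq> \<psi>" "\<theta> \<^bold>\<and> \<chi> \<sqsubseteq> \<psi>"
  shows "\<theta> \<^bold>\<and> (\<phi> \<^bold>\<or> \<chi>) \<sqsubseteq> \<psi>"
proof -
  have "\<phi> \<sqsubseteq> \<theta> \<^bold>\<rightarrow> \<psi>" "\<chi> \<sqsubseteq> \<theta> \<^bold>\<rightarrow> \<psi>"
    using assms leq_trans[OF conj_commute] by (auto simp: leq_imp_iff)
  then have "(\<phi> \<^bold>\<or> \<chi>) \<^bold>\<and> \<theta> \<sqsubseteq> \<psi>"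
    unfolding leq_imp_iff[symmetric] by (rule disj_leq)
  then show ?thesis
    by (rule leq_trans[OF conj_commute])
qed

lemma leq_disj_conj:
  assumes "\<theta> \<sqsubseteq> \<psi> \<^bold>\<or> \<phi>" "\<theta> \<sqsubseteq> \<psi> \<^bold>\<or> \<chi>"
  shows "\<theta> \<sqsubseteq> \<psi> \<^bold>\<or> (\<phi> \<^bold>\<and> \<chi>)"
  using assms unfolding coimp_leq_iff[symmetric] by (rule leq_conj)

section \<open>The operator \<open>\<Delta>\<close>\<close>

abbreviation conot ("\<^bold>- _" [80] 80) where "\<^bold>- \<phi> \<equiv> \<^bold>\<top> \<^bold>\<prec> \<phi>"

lemma leq_sim_iff: "\<phi> \<sqsubseteq> \<^bold>\<sim> \<chi> \<longleftrightarrow> \<phi> \<^bold>\<and> \<chi> \<sqsubseteq> \<^bold>\<bottom>"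
  by (simp add: sim_def leq_imp_iff)

lemma top_leq_iff: "\<^bold>\<top> \<sqsubseteq> \<phi> \<longleftrightarrow> prov \<phi>"
  using leq_prov leq_mp prov_top by blast

lemma conot_leq_iff: "\<^bold>- \<phi> \<sqsubseteq> \<chi> \<longleftrightarrow> prov (\<phi> \<^bold>\<or> \<chi>)"
  by (simp add: coimp_leq_iff top_leq_iff)

lemma prov_conot: "prov (\<phi> \<^bold>\<or> \<^bold>- \<phi>)"
  using conot_leq_iff leq_refl by blast

lemma colinear_leq: "(\<phi> \<^bold>\<prec> \<chi>) \<^bold>\<and> (\<chi> \<^bold>\<prec> \<phi>) \<sqsubseteq> \<^bold>\<bottom>"
  using prov_axiom[OF biG_axiom.colinear] by (simp add: leq_def sim_def)

text \<open>
  Dual prelinearity makes \<open>-\<phi> = \<top> \<prec> \<phi>\<close> disjoint from \<open>--\<phi>\<close>, which may fail in a bi-Heyting algebra: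
  as \<open>\<phi> \<or> -\<phi> = \<top>\<close>, the two elements are \<open>-\<phi> \<prec> \<phi>\<close> and \<open>\<phi> \<prec> -\<phi>\<close>.
\<close>

lemma conot_conot: "\<^bold>- \<phi> \<^bold>\<and> \<^bold>- \<^bold>- \<phi> \<sqsubseteq> \<^bold>\<bottom>"
proof -
  have *: "\<^bold>- \<chi> \<sqsubseteq> \<psi> \<^bold>\<prec> \<chi>" if "prov (\<chi> \<^bold>\<or> \<psi>)" for \<chi> \<psi>
    unfolding conot_leq_iff by (rule leq_mp[OF _ that]) (intro disj_leq leq_disj1 leq_coimp_disj)
  have "\<^bold>- \<phi> \<sqsubseteq> \<^bold>- \<phi> \<^bold>\<prec> \<phi>"
    by (rule *[OF prov_conot])
  moreover have "\<^bold>- \<^bold>- \<phi> \<sqsubseteq> \<phi> \<^bold>\<prec> \<^bold>- \<phi>"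
    by (rule *[OF leq_mp[OF disj_commute prov_conot]])
  ultimately show ?thesis
    by (intro leq_trans[OF conj_mono colinear_leq])
qed

lemma delta_conot: "delta \<phi> \<^bold>\<and> \<^bold>- \<phi> \<sqsubseteq> \<^bold>\<bottom>"
  using leq_refl by (simp add: delta_def leq_sim_iff[symmetric])

lemma leq_deltaI: "\<^bold>- \<phi> \<sqsubseteq> \<chi> \<Longrightarrow> \<psi> \<^bold>\<and> \<chi> \<sqsubseteq> \<^bold>\<bottom> \<Longrightarrow> \<psi> \<sqsubseteq> delta \<phi>"
  unfolding delta_def leq_sim_iff by (rule leq_trans[OF conj_mono[OF leq_refl]])

text \<open>
  The disjunction \<open>--\<phi> \<or> -\<phi>\<close> is always provable, and \<open>--\<phi>\<close> implies \<open>\<Delta>\<phi> = \<sim>-\<phi>\<close> by \<open>conot_conot\<close>.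
  So \<open>\<Delta>\<phi>\<close> and \<open>-\<phi>\<close> are complements, from which the remaining laws of \<open>\<Delta>\<close> follow.
\<close>

lemma delta_excluded_middle: "prov (delta \<phi> \<^bold>\<or> \<^bold>- \<phi>)"
proof -
  have "\<^bold>- \<^bold>- \<phi> \<sqsubseteq> delta \<phi>"
    by (rule leq_deltaI[OF leq_refl leq_trans[OF conj_commute conot_conot]])
  then show ?thesis
    unfolding conot_leq_iff by (rule leq_mp[OF disj_commute])
qed

lemma delta_leq: "delta \<phi> \<sqsubseteq> \<phi>"
proof -
  have "delta \<phi> \<sqsubseteq> delta \<phi> \<^bold>\<and> (\<phi> \<^bold>\<or> \<^bold>- \<phi>)"
    by (intro leq_conj leq_refl leq_prov prov_conot)
  also have "\<dots> \<sqsubseteq> \<phi>"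
    by (intro conj_disj_leq conj_leq2 leq_bot[OF delta_conot])
  finally show ?thesis .
qed

lemma delta_mono: "\<phi> \<sqsubseteq> \<chi> \<Longrightarrow> delta \<phi> \<sqsubseteq> delta \<chi>"
proof (rule leq_deltaI[OF _ delta_conot])
  assume "\<phi> \<sqsubseteq> \<chi>"
  then have "prov (\<chi> \<^bold>\<or> \<^bold>- \<phi>)"
    by (rule leq_mp[OF disj_mono[OF _ leq_refl] prov_conot])
  then show "\<^bold>- \<chi> \<sqsubseteq> \<^bold>- \<phi>"
    unfolding conot_leq_iff .
qed

lemma delta_delta: "delta \<phi> \<sqsubseteq> delta (delta \<phi>)"
  by (rule leq_deltaI[OF _ delta_conot]) (simp add: conot_leq_iff delta_excluded_middle)

lemma delta_conj: "delta \<phi> \<^bold>\<and> delta \<chi> \<sqsubseteq> delta (\<phi> \<^bold>\<and> \<chi>)"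
proof (rule leq_deltaI)
  let ?d = "\<^bold>- \<phi> \<^bold>\<or> \<^bold>- \<chi>"
  have "\<^bold>\<top> \<sqsubseteq> ?d \<^bold>\<or> \<phi>" "\<^bold>\<top> \<sqsubseteq> ?d \<^bold>\<or> \<chi>"
    using leq_mp[OF disj_commute leq_mp[OF disj_mono[OF leq_refl leq_disj1] prov_conot]]
      leq_mp[OF disj_commute leq_mp[OF disj_mono[OF leq_refl leq_disj2] prov_conot]]
    by (simp_all add: top_leq_iff)
  then have "\<^bold>\<top> \<sqsubseteq> ?d \<^bold>\<or> (\<phi> \<^bold>\<and> \<chi>)"
    by (rule leq_disj_conj)
  then show "\<^bold>- (\<phi> \<^bold>\<and> \<chi>) \<sqsubseteq> ?d"
    unfolding coimp_leq_iff by (rule leq_trans[OF _ disj_commute])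
  show "(delta \<phi> \<^bold>\<and> delta \<chi>) \<^bold>\<and> ?d \<sqsubseteq> \<^bold>\<bottom>"
    by (intro conj_disj_leq leq_trans[OF conj_mono[OF conj_leq1 leq_refl] delta_conot]
          leq_trans[OF conj_mono[OF conj_leq2 leq_refl] delta_conot])
qed

text \<open>
  The order dual of the Goedel law \<open>\<phi> \<and> \<chi> \<rightarrow> \<psi> = (\<phi> \<rightarrow> \<psi>) \<or> (\<chi> \<rightarrow> \<psi>)\<close> with \<open>\<psi> = \<bottom>\<close>: relative to
  \<open>-(\<phi> \<or> \<chi>)\<close>, the elements \<open>-\<phi>\<close> and \<open>-\<chi>\<close> lie below \<open>\<chi> \<prec> \<phi>\<close> and \<open>\<phi> \<prec> \<chi>\<close>, which are disjoint.
\<close>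

lemma conot_conj_conot: "\<^bold>- \<phi> \<^bold>\<and> \<^bold>- \<chi> \<sqsubseteq> \<^bold>- (\<phi> \<^bold>\<or> \<chi>)"
proof -
  let ?n = "\<^bold>- (\<phi> \<^bold>\<or> \<chi>)"
  have *: "prov (\<theta> \<^bold>\<or> (?n \<^bold>\<or> \<psi>))" if "\<phi> \<sqsubseteq> \<theta> \<^bold>\<or> \<psi>" "\<chi> \<sqsubseteq> \<theta> \<^bold>\<or> \<psi>" for \<theta> \<psi>
  proof (rule leq_mp[OF _ prov_conot])
    have "\<phi> \<^bold>\<or> \<chi> \<sqsubseteq> \<theta> \<^bold>\<or> \<psi>"
      using that by (rule disj_leq)
    also have "\<dots> \<sqsubseteq> \<theta> \<^bold>\<or> (?n \<^bold>\<or> \<psi>)"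
      by (intro disj_mono leq_refl leq_disj2)
    finally show "(\<phi> \<^bold>\<or> \<chi>) \<^bold>\<or> ?n \<sqsubseteq> \<theta> \<^bold>\<or> (?n \<^bold>\<or> \<psi>)"
      by (rule disj_leq) (rule leq_disjI2[OF leq_disj1])
  qed
  have "\<^bold>- \<phi> \<sqsubseteq> ?n \<^bold>\<or> (\<chi> \<^bold>\<prec> \<phi>)" "\<^bold>- \<chi> \<sqsubseteq> ?n \<^bold>\<or> (\<phi> \<^bold>\<prec> \<chi>)"
    unfolding conot_leq_iff by (intro * leq_disj1 leq_coimp_disj)+
  then have "\<^bold>- \<phi> \<^bold>\<and> \<^bold>- \<chi> \<sqsubseteq> ?n \<^bold>\<or> ((\<chi> \<^bold>\<prec> \<phi>) \<^bold>\<and> (\<phi> \<^bold>\<prec> \<chi>))"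
    by (intro leq_disj_conj) (rule conj_leqI1 conj_leqI2, assumption)+
  also have "\<dots> \<sqsubseteq> ?n"
    by (intro disj_leq leq_refl leq_bot[OF colinear_leq])
  finally show ?thesis .
qed

lemma delta_disj: "delta (\<phi> \<^bold>\<or> \<chi>) \<sqsubseteq> delta \<phi> \<^bold>\<or> delta \<chi>"
proof -
  let ?d = "delta \<phi> \<^bold>\<or> delta \<chi>" and ?e = "delta (\<phi> \<^bold>\<or> \<chi>)"
  have "?e \<sqsubseteq> ?d \<^bold>\<or> \<^bold>- \<phi>" "?e \<sqsubseteq> ?d \<^bold>\<or> \<^bold>- \<chi>"
    using leq_mp[OF disj_mono[OF leq_disj1 leq_refl] delta_excluded_middle]
      leq_mp[OF disj_mono[OF leq_disj2 leq_refl] delta_excluded_middle]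
    by (auto intro: leq_prov)
  then have "?e \<sqsubseteq> ?d \<^bold>\<or> (\<^bold>- \<phi> \<^bold>\<and> \<^bold>- \<chi>)"
    by (rule leq_disj_conj)
  also have "\<dots> \<sqsubseteq> ?d \<^bold>\<or> \<^bold>- (\<phi> \<^bold>\<or> \<chi>)"
    by (intro disj_mono leq_refl conot_conj_conot)
  finally have "?e \<sqsubseteq> ?e \<^bold>\<and> (?d \<^bold>\<or> \<^bold>- (\<phi> \<^bold>\<or> \<chi>))"
    by (intro leq_conj leq_refl)
  also have "\<dots> \<sqsubseteq> ?d"
    by (intro conj_disj_leq conj_leq2 leq_bot[OF delta_conot])
  finally show ?thesis .
qed

end

section \<open>Embedding countable chains in \<open>[0,1]\<close>\<close>

text \<open>
  The rank of \<open>x\<close> is the sum of the weights \<open>2\<^sup>-\<^sup>n\<close> of the elements \<open>z\<close> with \<open>R z x\<close>, where \<open>n\<close> is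
  the code of \<open>z\<close>.  It is strictly monotone since \<open>x\<close> contributes a positive weight of its own.
\<close>

lemma countable_chain_rank:
  fixes R :: "'a \<Rightarrow> 'a \<Rightarrow> bool" and code :: "'a \<Rightarrow> nat"
  assumes "inj code"
    and total: "\<And>x y. R x y \<or> R y x" and trans: "\<And>x y z. R x y \<Longrightarrow> R y z \<Longrightarrow> R x z"
  shows "\<exists>f :: 'a \<Rightarrow> real. \<forall>x y. f x \<le> f y \<longleftrightarrow> R x y"
proof -
  define g :: "'a \<Rightarrow> nat \<Rightarrow> real" where
    "g x n = (if \<exists>z. code z = n \<and> R z x then (1/2)^n else 0)" for x n
  have summable: "summable (g x)" for x
    by (rule summable_comparison_test'[of "\<lambda>n. (1/2)^n" 0]) (auto simp: g_def summable_geometric)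
  have mono: "g x n \<le> g y n" if "R x y" for x y n
    using trans[OF _ that] by (auto simp: g_def)
  have "suminf (g x) < suminf (g y)" if "\<not> R y x" for x y
  proof -
    have "g x (code y) = 0" "g y (code y) > 0"
      using that total[of y y] \<open>inj code\<close> by (auto simp: g_def inj_eq)
    then have "0 < (\<Sum>n. g y n - g x n)"
      using mono[of x y] total[of x y] that
      by (intro suminf_pos2[where i = "code y"] summable_diff summable) auto
    then show ?thesis
      by (simp add: suminf_diff[OF summable summable, symmetric])
  qed
  moreover have "suminf (g x) \<le> suminf (g y)" if "R x y" for x y
    by (rule suminf_le[OF mono[OF that] summable summable])
  ultimately show ?thesis
    by (intro exI[of _ "\<lambda>x. suminf (g x)"]) (meson linorder_not_le)
qed

text \<open>
  The rank is normalised to \<open>[0,1]\<close> and then compressed to the lower third outside \<open>U\<close> and to the upper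
  third on \<open>U\<close>.  The gap keeps the infimum over an infinite part of \<open>U\<close> away from the values outside \<open>U\<close>.
\<close>

lemma countable_chain_embedding:
  fixes R :: "'a \<Rightarrow> 'a \<Rightarrow> bool" and code :: "'a \<Rightarrow> nat"
  assumes "inj code"
    and total: "\<And>x y. R x y \<or> R y x" and trans: "\<And>x y z. R x y \<Longrightarrow> R y z \<Longrightarrow> R x z"
    and least: "\<And>x. R b x" and greatest: "\<And>x. R x t"
    and U: "\<And>x y. x \<in> U \<Longrightarrow> R x y \<Longrightarrow> y \<in> U" "t \<in> U" "b \<notin> U"
  shows "\<exists>v :: 'a \<Rightarrow> real. (\<forall>x y. v x \<le> v y \<longleftrightarrow> R x y) \<and> v b = 0 \<and> v t = 1 \<and>
           (\<forall>x. if x \<in> U then 2/3 \<le> v x else v x \<le> 1/3)"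
proof -
  obtain f :: "'a \<Rightarrow> real" where f: "\<And>x y. f x \<le> f y \<longleftrightarrow> R x y"
    using countable_chain_rank[OF assms(1), of R] total trans by blast
  have bt: "f b < f t"
    using U f by (metis linorder_not_le)
  define h where "h x = (f x - f b) / (f t - f b)" for x
  have h: "h x \<le> h y \<longleftrightarrow> R x y" "0 \<le> h x" "h x \<le> 1" for x y
    using bt f least greatest by (auto simp: h_def divide_simps)
  have hbt: "h b = 0" "h t = 1"
    using bt by (auto simp: h_def)
  define v where "v x = (if x \<in> U then 2 + h x else h x) / 3" for x
  have "v x \<le> v y \<longleftrightarrow> R x y" for x y
    using U(1)[of x y] U(1)[of y x] total[of x y] h(1)[of x y] h(2,3)[of x] h(2,3)[of y]
    by (auto simp: v_def simp del: h(1))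
  moreover have "v b = 0" "v t = 1"
    using U hbt by (auto simp: v_def)
  moreover have "if x \<in> U then 2/3 \<le> v x else v x \<le> 1/3" for x
    using h(2,3)[of x] by (auto simp: v_def)
  ultimately show ?thesis by blast
qed

section \<open>Completeness of bi-Goedel logic\<close>

context biG_logic
begin

lemma deductive_Union:
  assumes "subset.chain {T. deductive prov T} K" "K \<noteq> {}"
  shows "deductive prov (\<Union>K)"
proof -
  have d: "deductive prov T" if "T \<in> K" for T
    using assms that by (auto simp: subset.chain_def)
  moreover have "\<chi> \<in> \<Union>K" if "\<phi> \<in> S" "S \<in> K" "(\<phi> \<^bold>\<rightarrow> \<chi>) \<in> T" "T \<in> K" for \<phi> \<chi> S T
  proof -
    have "S \<subseteq> T \<or> T \<subseteq> S"
      using assms that by (auto simp: subset_chain_def)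
    then show ?thesis
      using that d unfolding deductive_def by blast
  qed
  ultimately show ?thesis
    using \<open>K \<noteq> {}\<close> unfolding deductive_def by (metis UnionE UnionI equals0I)
qed

lemma deductive_leq: "deductive prov T \<Longrightarrow> \<phi> \<sqsubseteq> \<chi> \<Longrightarrow> \<phi> \<in> T \<Longrightarrow> \<chi> \<in> T"
  unfolding deductive_def leq_def by blast

lemma deductive_conj: "deductive prov T \<Longrightarrow> \<phi> \<in> T \<Longrightarrow> \<chi> \<in> T \<Longrightarrow> \<phi> \<^bold>\<and> \<chi> \<in> T"
  using leq_imp_iff[of \<phi> \<chi> "\<phi> \<^bold>\<and> \<chi>"] leq_refl deductive_leq
  unfolding deductive_def by blast

text \<open>
  The set of all \<open>\<theta>\<close> with \<open>\<phi> \<rightarrow> \<theta> \<in> T\<close> is deductively closed; this is the deduction theorem, stated so that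
  no derivations need to be inspected.
\<close>

lemma deductive_adjoin:
  assumes "deductive prov T"
  shows "deductive prov {\<theta>. (\<phi> \<^bold>\<rightarrow> \<theta>) \<in> T}" "insert \<phi> T \<subseteq> {\<theta>. (\<phi> \<^bold>\<rightarrow> \<theta>) \<in> T}"
proof -
  have prov: "prov \<theta> \<Longrightarrow> \<theta> \<in> T" for \<theta>
    using assms by (auto simp: deductive_def)
  have mp: "(\<phi> \<^bold>\<rightarrow> \<chi>) \<in> T" if "(\<phi> \<^bold>\<rightarrow> \<psi>) \<in> T" "(\<phi> \<^bold>\<rightarrow> (\<psi> \<^bold>\<rightarrow> \<chi>)) \<in> T" for \<psi> \<chi>
  proof (rule deductive_leq[OF assms _ deductive_conj[OF assms that]])
    let ?a = "(\<phi> \<^bold>\<rightarrow> \<psi>) \<^bold>\<and> (\<phi> \<^bold>\<rightarrow> (\<psi> \<^bold>\<rightarrow> \<chi>))"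
    have "?a \<^bold>\<and> \<phi> \<sqsubseteq> \<psi>" "?a \<^bold>\<and> \<phi> \<sqsubseteq> \<psi> \<^bold>\<rightarrow> \<chi>"
      by (rule leq_trans[OF conj_mono[OF conj_leq1 leq_refl] imp_elim]
               leq_trans[OF conj_mono[OF conj_leq2 leq_refl] imp_elim])+
    then have "?a \<^bold>\<and> \<phi> \<sqsubseteq> (\<psi> \<^bold>\<rightarrow> \<chi>) \<^bold>\<and> \<psi>"
      by (rule leq_conj[rotated])
    then show "?a \<sqsubseteq> \<phi> \<^bold>\<rightarrow> \<chi>"
      unfolding leq_imp_iff by (rule leq_trans[OF _ imp_elim])
  qed
  have weaken: "(\<phi> \<^bold>\<rightarrow> \<theta>) \<in> T" if "\<theta> \<in> T" for \<theta>
    by (rule deductive_leq[OF assms _ that]) (simp add: leq_imp_iff conj_leq1)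
  show "deductive prov {\<theta>. (\<phi> \<^bold>\<rightarrow> \<theta>) \<in> T}"
    unfolding deductive_def mem_Collect_eq by (blast intro: mp weaken prov)
  show "insert \<phi> T \<subseteq> {\<theta>. (\<phi> \<^bold>\<rightarrow> \<theta>) \<in> T}"
    using prov leq_refl[of \<phi>] weaken by (auto simp: leq_def)
qed

text \<open>
  A deductively closed set that is maximal without \<open>\<alpha>\<close> contains \<open>\<phi> \<rightarrow> \<alpha>\<close> for each \<open>\<phi>\<close> outside it, so it
  cannot contain a disjunction of two such formulas.
\<close>

lemma prime_extension:
  assumes "deductive prov D" "\<alpha> \<notin> D"
  shows "\<exists>T. deductive prov T \<and> D \<subseteq> T \<and> \<alpha> \<notin> T \<and>
             (\<forall>\<phi> \<chi>. \<phi> \<^bold>\<or> \<chi> \<in> T \<longrightarrow> \<phi> \<in> T \<or> \<chi> \<in> T)"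
proof -
  define A where "A = {T. deductive prov T \<and> D \<subseteq> T \<and> \<alpha> \<notin> T}"
  have "D \<in> A"
    using assms by (auto simp: A_def)
  moreover have "\<Union>K \<in> A" if "K \<noteq> {}" "subset.chain A K" for K
  proof -
    have "subset.chain {T. deductive prov T} K"
      using that by (auto simp: subset.chain_def A_def)
    then show ?thesis
      using that deductive_Union[of K] by (fastforce simp: A_def subset.chain_def)
  qed
  ultimately obtain T where T: "T \<in> A" "\<And>S. S \<in> A \<Longrightarrow> T \<subseteq> S \<Longrightarrow> S = T"
    using subset_Zorn_nonempty[of A] by blast
  have d: "deductive prov T"
    using T by (auto simp: A_def)
  have *: "\<phi> \<^bold>\<rightarrow> \<alpha> \<in> T" if "\<phi> \<notin> T" for \<phi>
    using that deductive_adjoin[OF d, of \<phi>] T unfolding A_def by blast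
  have "\<phi> \<in> T \<or> \<chi> \<in> T" if "\<phi> \<^bold>\<or> \<chi> \<in> T" for \<phi> \<chi>
  proof (rule ccontr)
    assume "\<not> (\<phi> \<in> T \<or> \<chi> \<in> T)"
    then have "\<alpha> \<in> T"
      using that * ax(4)[of \<phi> \<alpha> \<chi>] d unfolding deductive_def by meson
    then show False
      using T by (auto simp: A_def)
  qed
  then show ?thesis
    using T d by (auto simp: A_def)
qed

text \<open>
  The comparison \<open>R\<close> by \<open>\<Delta>(\<phi> \<rightarrow> \<chi>) \<in> T\<close> is total by linearity and \<open>delta_disj\<close>, transitive by
  \<open>delta_conj\<close>, and respected by \<open>T\<close> because \<open>\<Delta>\<close> is deflationary.  That \<open>v\<close> commutes with the connectives
  is then order reasoning in a chain: if \<open>\<phi>\<close> is not below \<open>\<chi>\<close>, then \<open>(\<phi> \<rightarrow> \<chi>) \<and> \<phi> \<sqsubseteq> \<chi>\<close> forces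
  \<open>\<phi> \<rightarrow> \<chi>\<close> down to \<open>\<chi>\<close>, and \<open>\<phi> \<sqsubseteq> \<chi> \<or> (\<phi> \<prec> \<chi>)\<close> forces \<open>\<phi> \<prec> \<chi>\<close> up to \<open>\<phi>\<close>.
\<close>

theorem separating_valuation:
  fixes code :: "'a \<Rightarrow> nat"
  assumes "inj code" "deductive prov D" "\<alpha> \<notin> D"
  shows "\<exists>v. valuation v \<and> (\<forall>\<phi>. prov \<phi> \<longrightarrow> v \<phi> = 1) \<and> v \<alpha> \<le> 1/3 \<and> (\<forall>\<psi>\<in>D. 2/3 \<le> v \<psi>)"
proof -
  obtain T where T: "deductive prov T" "D \<subseteq> T" "\<alpha> \<notin> T"
      and prime: "\<And>\<phi> \<chi>. \<phi> \<^bold>\<or> \<chi> \<in> T \<Longrightarrow> \<phi> \<in> T \<or> \<chi> \<in> T"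
    using prime_extension[OF assms(2,3)] by blast
  define R where "R \<phi> \<chi> \<longleftrightarrow> delta (\<phi> \<^bold>\<rightarrow> \<chi>) \<in> T" for \<phi> \<chi>
  have provT: "prov \<phi> \<Longrightarrow> \<phi> \<in> T" for \<phi>
    using T(1) by (simp add: deductive_def)
  have R1: "R \<phi> \<chi>" if "\<phi> \<sqsubseteq> \<chi>" for \<phi> \<chi>
    using that provT prov_nec by (auto simp: R_def leq_def)
  have R_mono: "R \<phi>' \<chi>'" if "(\<phi> \<^bold>\<rightarrow> \<chi>) \<sqsubseteq> (\<phi>' \<^bold>\<rightarrow> \<chi>')" "R \<phi> \<chi>" for \<phi> \<chi> \<phi>' \<chi>'
    using that deductive_leq[OF T(1) delta_mono] unfolding R_def by blast
  have R_mono2: "R \<phi>'' \<chi>''"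
    if "(\<phi> \<^bold>\<rightarrow> \<chi>) \<^bold>\<and> (\<phi>' \<^bold>\<rightarrow> \<chi>') \<sqsubseteq> (\<phi>'' \<^bold>\<rightarrow> \<chi>'')" "R \<phi> \<chi>" "R \<phi>' \<chi>'" for \<phi> \<chi> \<phi>' \<chi>' \<phi>'' \<chi>''
  proof -
    have "delta ((\<phi> \<^bold>\<rightarrow> \<chi>) \<^bold>\<and> (\<phi>' \<^bold>\<rightarrow> \<chi>')) \<in> T"
      using that deductive_leq[OF T(1) delta_conj deductive_conj[OF T(1)]] unfolding R_def by blast
    then show ?thesis
      using that deductive_leq[OF T(1) delta_mono] unfolding R_def by blast
  qed
  have total: "R \<phi> \<chi> \<or> R \<chi> \<phi>" for \<phi> \<chi>
    unfolding R_def
    by (intro prime deductive_leq[OF T(1) delta_disj] provT prov_nec ax)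
  have R_trans: "R \<phi> \<psi>" if "R \<phi> \<chi>" "R \<chi> \<psi>" for \<phi> \<chi> \<psi>
    by (rule R_mono2[OF _ that]) (simp add: leq_imp_iff[of "\<phi> \<^bold>\<rightarrow> \<chi>", symmetric], simp add: leq_def ax(1))
  have R_conj: "R \<phi> (\<chi> \<^bold>\<and> \<psi>)" if "R \<phi> \<chi>" "R \<phi> \<psi>" for \<phi> \<chi> \<psi>
    by (rule R_mono2[OF _ that]) (simp add: leq_imp_iff[of "\<phi> \<^bold>\<rightarrow> \<chi>", symmetric], simp add: leq_def ax(7))
  have R_disj: "R (\<phi> \<^bold>\<or> \<chi>) \<psi>" if "R \<phi> \<psi>" "R \<chi> \<psi>" for \<phi> \<chi> \<psi>
    by (rule R_mono2[OF _ that]) (simp add: leq_imp_iff[of "\<phi> \<^bold>\<rightarrow> \<psi>", symmetric], simp add: leq_def ax(4))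
  have up: "\<chi> \<in> T" if "\<phi> \<in> T" "R \<phi> \<chi>" for \<phi> \<chi>
  proof -
    have "(\<phi> \<^bold>\<rightarrow> \<chi>) \<in> T"
      using deductive_leq[OF T(1) delta_leq] that by (simp add: R_def)
    then show ?thesis
      using T(1) that(1) unfolding deductive_def by meson
  qed
  have "\<^bold>\<bottom> \<notin> T"
    using T deductive_leq[OF T(1) bot_leq] by blast
  then have "\<exists>v :: 'a \<Rightarrow> real. (\<forall>\<phi> \<chi>. v \<phi> \<le> v \<chi> \<longleftrightarrow> R \<phi> \<chi>) \<and> v \<^bold>\<bottom> = 0 \<and> v \<^bold>\<top> = 1 \<and>
               (\<forall>\<phi>. if \<phi> \<in> T then 2/3 \<le> v \<phi> else v \<phi> \<le> 1/3)"
    by (intro countable_chain_embedding[OF assms(1)] total R1[OF bot_leq]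
          R1[OF leq_prov[OF prov_top]] provT[OF prov_top]) (blast intro: R_trans up)+
  then obtain v :: "'a \<Rightarrow> real" where
      v: "\<And>\<phi> \<chi>. v \<phi> \<le> v \<chi> \<longleftrightarrow> R \<phi> \<chi>" "v \<^bold>\<bottom> = 0" "v \<^bold>\<top> = 1"
        "\<And>\<phi>. if \<phi> \<in> T then 2/3 \<le> v \<phi> else v \<phi> \<le> 1/3"
    by blast
  have le: "v \<phi> \<le> v \<chi>" if "\<phi> \<sqsubseteq> \<chi>" for \<phi> \<chi>
    using that v(1) R1 by blast
  have bounds: "0 \<le> v \<phi>" "v \<phi> \<le> 1" for \<phi>
    using le[OF bot_leq] le[OF leq_prov[OF prov_top]] v(2,3) by metis+
  have one: "v \<phi> = 1" if "prov \<phi>" for \<phi>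
    using le[OF leq_prov[OF that], of "\<^bold>\<top>"] bounds[of \<phi>] v(3) by simp
  have v_conj: "v (\<phi> \<^bold>\<and> \<chi>) = min (v \<phi>) (v \<chi>)" for \<phi> \<chi>
  proof (rule antisym)
    show "v (\<phi> \<^bold>\<and> \<chi>) \<le> min (v \<phi>) (v \<chi>)"
      using le conj_leq1 conj_leq2 by simp
    show "min (v \<phi>) (v \<chi>) \<le> v (\<phi> \<^bold>\<and> \<chi>)"
      using R_conj[of \<phi> \<phi> \<chi>] R_conj[of \<chi> \<phi> \<chi>] v(1) by (metis min_def nle_le)
  qed
  have v_disj: "v (\<phi> \<^bold>\<or> \<chi>) = max (v \<phi>) (v \<chi>)" for \<phi> \<chi>
  proof (rule antisym)
    show "max (v \<phi>) (v \<chi>) \<le> v (\<phi> \<^bold>\<or> \<chi>)"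
      using le leq_disj1 leq_disj2 by simp
    show "v (\<phi> \<^bold>\<or> \<chi>) \<le> max (v \<phi>) (v \<chi>)"
      using R_disj[of \<phi> \<chi> \<chi>] R_disj[of \<phi> \<phi> \<chi>] v(1) by (metis max_def nle_le)
  qed
  have v_imp: "v (\<phi> \<^bold>\<rightarrow> \<chi>) = biG_imp (v \<phi>) (v \<chi>)" for \<phi> \<chi>
  proof (cases "v \<phi> \<le> v \<chi>")
    case True
    have "\<phi> \<^bold>\<rightarrow> \<chi> \<sqsubseteq> \<^bold>\<top> \<^bold>\<rightarrow> (\<phi> \<^bold>\<rightarrow> \<chi>)"
      by (simp only: leq_imp_iff[of _ "\<^bold>\<top>"] conj_leq1)
    then have "R \<^bold>\<top> (\<phi> \<^bold>\<rightarrow> \<chi>)"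
      by (rule R_mono) (use True v(1) in blast)
    then show ?thesis
      using True v(1)[of "\<^bold>\<top>"] v(3) bounds by (auto simp: biG_imp_def intro: antisym)
  next
    case False
    have "\<not> v \<phi> \<le> v (\<phi> \<^bold>\<rightarrow> \<chi>)"
    proof
      assume "v \<phi> \<le> v (\<phi> \<^bold>\<rightarrow> \<chi>)"
      then have "v \<phi> \<le> v ((\<phi> \<^bold>\<rightarrow> \<chi>) \<^bold>\<and> \<phi>)"
        by (simp add: v_conj)
      then show False
        using False le[OF imp_elim[of \<phi> \<chi>]] by simp
    qed
    then have "v (\<phi> \<^bold>\<rightarrow> \<chi>) = v ((\<phi> \<^bold>\<rightarrow> \<chi>) \<^bold>\<and> \<phi>)"
      by (simp add: v_conj)
    moreover have "v \<chi> \<le> v (\<phi> \<^bold>\<rightarrow> \<chi>)"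
      by (rule le) (simp add: leq_imp_iff conj_leq1)
    ultimately show ?thesis
      using False le[OF imp_elim[of \<phi> \<chi>]] by (simp add: biG_imp_def)
  qed
  have v_coimp: "v (\<phi> \<^bold>\<prec> \<chi>) = biG_coimp (v \<phi>) (v \<chi>)" for \<phi> \<chi>
  proof (cases "v \<phi> \<le> v \<chi>")
    case True
    have "delta (\<phi> \<^bold>\<rightarrow> \<chi>) \<sqsubseteq> (\<phi> \<^bold>\<prec> \<chi>) \<^bold>\<rightarrow> \<^bold>\<bottom>"
      unfolding leq_imp_iff
      by (rule leq_trans[OF conj_mono[OF leq_refl] delta_conot]) (simp add: leq_def ax(11))
    \<comment> \<open>Membership of \<open>(\<phi> \<prec> \<chi>) \<rightarrow> \<bottom>\<close> in \<open>T\<close> does not suffice for \<open>R\<close>; idempotency of \<open>\<Delta>\<close> adds the outer \<open>\<Delta>\<close>.\<close>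
    from deductive_leq[OF T(1) leq_trans[OF delta_delta delta_mono[OF this]]]
    have "R (\<phi> \<^bold>\<prec> \<chi>) \<^bold>\<bottom>"
      using True v(1) by (simp add: R_def)
    then show ?thesis
      using True v(1)[of _ "\<^bold>\<bottom>"] v(2) bounds by (auto simp: biG_coimp_def intro: antisym)
  next
    case False
    have "v \<phi> \<le> max (v \<chi>) (v (\<phi> \<^bold>\<prec> \<chi>))"
      using le[OF leq_coimp_disj[of \<phi> \<chi>]] by (simp add: v_disj)
    moreover have "v (\<phi> \<^bold>\<prec> \<chi>) \<le> v \<phi>"
      by (rule le) (simp add: coimp_leq_iff leq_disj2)
    ultimately show ?thesis
      using False by (simp add: biG_coimp_def max_def split: if_splits)
  qed
  have "valuation v"
    using bounds v_conj v_disj v_imp v_coimp by (simp add: valuation_def)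
  then show ?thesis
    using one v(4) T(2,3) by (metis subsetD)
qed

end

section \<open>Measured Belnap--Dunn models\<close>

instance bd :: countable
  by countable_datatype

instance g2 :: (countable) countable
  by countable_datatype

instance n2 :: (countable) countable
  by countable_datatype

primrec bd_atoms :: "bd \<Rightarrow> atm set" where
  "bd_atoms (PVar p) = {p}"
| "bd_atoms (BNeg \<phi>) = bd_atoms \<phi>"
| "bd_atoms (BAnd \<phi> \<psi>) = bd_atoms \<phi> \<union> bd_atoms \<psi>"
| "bd_atoms (BOr \<phi> \<psi>) = bd_atoms \<phi> \<union> bd_atoms \<psi>"

lemma finite_bd_atoms: "finite (bd_atoms \<phi>)"
  by (induction \<phi>) auto

lemma supp_cong:
  assumes "\<And>p. p \<in> bd_atoms \<phi> \<Longrightarrow> (w \<in> vpos M p \<longleftrightarrow> u \<in> vpos N p) \<and> (w \<in> vneg M p \<longleftrightarrow> u \<in> vneg N p)"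
  shows "supp_pos M w \<phi> \<longleftrightarrow> supp_pos N u \<phi>" "supp_neg M w \<phi> \<longleftrightarrow> supp_neg N u \<phi>"
  using assms by (induction \<phi>) auto

text \<open>
  Exchanging ``true'' with ``not false'' at every atom does so at every formula.  This links positive and
  negative support: it makes the negative half of validity follow from the positive half, and it
  underlies the duality of \<open>MCB\<close> models.
\<close>

lemma supp_dual:
  assumes "\<And>p. p \<in> bd_atoms \<phi> \<Longrightarrow> (w \<in> vpos M p \<longleftrightarrow> u \<notin> vneg N p) \<and> (w \<in> vneg M p \<longleftrightarrow> u \<notin> vpos N p)"
  shows "supp_pos M w \<phi> \<longleftrightarrow> \<not> supp_neg N u \<phi>" "supp_neg M w \<phi> \<longleftrightarrow> \<not> supp_pos N u \<phi>"
  using assms by (induction \<phi>) auto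

lemma ext_neg_eq_ext_pos: "ext_neg M \<phi> = ext_pos M (BNeg \<phi>)"
  by (simp add: ext_neg_def ext_pos_def)

lemma ext_mono_if_bd_valid:
  assumes "bd_valid \<phi> \<chi>" "is_bd_model (M :: ('w, 'z) bd_model_scheme)"
  shows "ext_pos M \<phi> \<subseteq> ext_pos M \<chi>" "ext_neg M \<chi> \<subseteq> ext_neg M \<phi>"
proof -
  define N :: "'w bd_model" where "N = \<lparr>worlds = worlds M, vpos = vpos M, vneg = vneg M\<rparr>"
  have "supp_pos N w \<psi> = supp_pos M w \<psi>" "supp_neg N w \<psi> = supp_neg M w \<psi>" for w \<psi>
    by (rule supp_cong; simp add: N_def)+
  then have "ext_pos N \<psi> = ext_pos M \<psi>" "ext_neg N \<psi> = ext_neg M \<psi>" for \<psi>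
    by (simp_all add: ext_pos_def ext_neg_def) (simp_all add: N_def)
  moreover have "bd_valid_in TYPE('w) \<phi> \<chi>" "is_bd_model N"
    using assms by (simp_all add: bd_valid_in_cong N_def is_bd_model_def)
  ultimately show "ext_pos M \<phi> \<subseteq> ext_pos M \<chi>" "ext_neg M \<chi> \<subseteq> ext_neg M \<phi>"
    unfolding bd_valid_in_def by metis+
qed

text \<open>
  A world is a pair of lists, of the atoms that it supports positively and negatively.  Support of a
  formula depends on finitely many atoms, so each world of each model, and its dual, is copied on these
  atoms by one of these countably many.  The world with all relevant literals supports a given formula
  and the empty world supports none, so no \<open>|\<phi>|\<^sup>+\<close> is empty or everything.
\<close>

lemma canonical_bd_model:
  assumes "infinite (UNIV :: 'w set)"
  shows "\<exists>M :: 'w bd_model. is_bd_model M \<and>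
    (\<forall>\<phi> \<chi>. ext_pos M \<phi> \<subseteq> ext_pos M \<chi> \<longrightarrow> bd_valid \<phi> \<chi>) \<and>
    (\<forall>\<phi>. ext_pos M \<phi> \<noteq> {} \<and> ext_pos M \<phi> \<noteq> worlds M)"
proof -
  obtain i :: "nat \<Rightarrow> 'w" where "inj i"
    using assms infinite_countable_subset by blast
  define g :: "atm list \<times> atm list \<Rightarrow> 'w" where "g = i \<circ> to_nat"
  have "inj g"
    unfolding g_def by (intro inj_compose \<open>inj i\<close>) simp
  define M :: "'w bd_model" where
    "M = \<lparr>worlds = range g, vpos = (\<lambda>p. g ` {s. p \<in> set (fst s)}), vneg = (\<lambda>p. g ` {s. p \<in> set (snd s)})\<rparr>"
  have v: "worlds M = range g" "g s \<in> vpos M p \<longleftrightarrow> p \<in> set (fst s)" "g s \<in> vneg M p \<longleftrightarrow> p \<in> set (snd s)" for s p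
    using \<open>inj g\<close> by (auto simp: M_def inj_eq)
  have state: "\<exists>s. \<forall>p. (g s \<in> vpos M p \<longleftrightarrow> p \<in> A \<and> P p) \<and> (g s \<in> vneg M p \<longleftrightarrow> p \<in> A \<and> Q p)"
    if A: "finite A" for A P Q
  proof -
    obtain xs ys where "set xs = {p \<in> A. P p}" "set ys = {p \<in> A. Q p}"
      using finite_list[of "{p \<in> A. P p}"] finite_list[of "{p \<in> A. Q p}"] A by auto
    then show ?thesis
      by (intro exI[of _ "(xs, ys)"]) (simp add: v)
  qed
  have "bd_valid \<phi> \<chi>" if sub: "ext_pos M \<phi> \<subseteq> ext_pos M \<chi>" for \<phi> \<chi>
  proof -
    define A where "A = bd_atoms \<phi> \<union> bd_atoms \<chi>"
    have A: "finite A" "bd_atoms \<phi> \<subseteq> A" "bd_atoms \<chi> \<subseteq> A"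
      by (simp_all add: A_def finite_bd_atoms)
    have imp: "supp_pos M (g s) \<phi> \<Longrightarrow> supp_pos M (g s) \<chi>" for s
      using sub by (auto simp: ext_pos_def v)
    have "(supp_pos N w \<phi> \<longrightarrow> supp_pos N w \<chi>) \<and> (supp_neg N w \<chi> \<longrightarrow> supp_neg N w \<phi>)"
      for N :: "nat bd_model" and w
    proof (intro conjI impI)
      obtain s where s: "\<And>p. (g s \<in> vpos M p \<longleftrightarrow> p \<in> A \<and> w \<in> vpos N p) \<and>
                             (g s \<in> vneg M p \<longleftrightarrow> p \<in> A \<and> w \<in> vneg N p)"
        using state[OF A(1), of "\<lambda>p. w \<in> vpos N p" "\<lambda>p. w \<in> vneg N p"] by blast
      have "supp_pos M (g s) \<psi> \<longleftrightarrow> supp_pos N w \<psi>" if "bd_atoms \<psi> \<subseteq> A" for \<psi>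
        by (rule supp_cong) (use s that in auto)
      then show "supp_pos N w \<chi>" if "supp_pos N w \<phi>"
        using imp[of s] that A by simp
    next
      obtain s where s: "\<And>p. (g s \<in> vpos M p \<longleftrightarrow> p \<in> A \<and> w \<notin> vneg N p) \<and>
                             (g s \<in> vneg M p \<longleftrightarrow> p \<in> A \<and> w \<notin> vpos N p)"
        using state[OF A(1), of "\<lambda>p. w \<notin> vneg N p" "\<lambda>p. w \<notin> vpos N p"] by blast
      have "supp_pos M (g s) \<psi> \<longleftrightarrow> \<not> supp_neg N w \<psi>" if "bd_atoms \<psi> \<subseteq> A" for \<psi>
        by (rule supp_dual) (use s that in auto)
      then show "supp_neg N w \<phi>" if "supp_neg N w \<chi>"
        using imp[of s] that A by auto
    qed
    then show ?thesis
      unfolding bd_valid_def bd_valid_in_def ext_pos_def ext_neg_def by blast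
  qed
  moreover have "ext_pos M \<phi> \<noteq> {}" for \<phi>
  proof -
    obtain s where "\<And>p. p \<in> bd_atoms \<phi> \<Longrightarrow> g s \<in> vpos M p \<and> g s \<in> vneg M p"
      using state[OF finite_bd_atoms, of \<phi> "\<lambda>_. True" "\<lambda>_. True"] by blast
    then have "supp_pos M (g s) \<phi> \<and> supp_neg M (g s) \<phi>"
      by (induction \<phi>) auto
    then have "g s \<in> ext_pos M \<phi>"
      by (simp add: ext_pos_def v)
    then show ?thesis
      by blast
  qed
  moreover have "ext_pos M \<phi> \<noteq> worlds M" for \<phi>
  proof -
    have "\<not> supp_pos M (g ([], [])) \<phi> \<and> \<not> supp_neg M (g ([], [])) \<phi>"
      by (induction \<phi>) (auto simp: v)
    then show ?thesis
      by (auto simp: ext_pos_def v)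
  qed
  moreover have "is_bd_model M"
    by (auto simp: is_bd_model_def M_def)
  ultimately show ?thesis by blast
qed

text \<open>
  Any monotone function on formulas comes from an uncertainty measure.  Because no \<open>|\<phi>|\<^sup>+\<close> is empty or the
  whole set of worlds, the values of the measure at these two sets may be chosen to be \<open>0\<close> and \<open>1\<close>, which
  gives \<open>\<pi>(W) > \<pi>(\<emptyset>)\<close> for every \<open>p\<close>, even a constant one.
\<close>

lemma cb_model_realizing:
  fixes p :: "bd \<Rightarrow> real"
  assumes "infinite (UNIV :: 'w set)"
    and bounds: "\<And>\<phi>. 0 \<le> p \<phi> \<and> p \<phi> \<le> 1" and mono: "\<And>\<phi> \<chi>. bd_valid \<phi> \<chi> \<Longrightarrow> p \<phi> \<le> p \<chi>"
  shows "\<exists>M :: 'w cb_model. is_cb_model M \<and> (\<forall>\<phi>. measure M (ext_pos M \<phi>) = p \<phi>)"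
proof -
  obtain K :: "'w bd_model" where K: "is_bd_model K"
      "\<And>\<phi> \<chi>. ext_pos K \<phi> \<subseteq> ext_pos K \<chi> \<Longrightarrow> bd_valid \<phi> \<chi>"
      "\<And>\<phi>. ext_pos K \<phi> \<noteq> {}" "\<And>\<phi>. ext_pos K \<phi> \<noteq> worlds K"
    using canonical_bd_model[OF assms(1)] by blast
  \<comment> \<open>The element \<open>0\<close> makes the supremum at the empty set equal to \<open>0\<close>.\<close>
  define below where "below X = insert 0 (p ` {\<phi>. ext_pos K \<phi> \<subseteq> X})" for X
  define \<pi> where "\<pi> X = (if X = worlds K then 1 else Sup (below X))" for X
  define M where "M = \<lparr>worlds = worlds K, vpos = vpos K, vneg = vneg K, measure = \<pi>\<rparr>"
  have bdd: "bdd_above (below X)" for X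
    using bounds by (auto simp: below_def intro!: bdd_aboveI)
  have le1: "Sup (below X) \<le> 1" for X
    using bounds by (intro cSup_least) (auto simp: below_def)
  have ge0: "0 \<le> Sup (below X)" for X
    by (rule cSup_upper[OF _ bdd]) (simp add: below_def)
  have \<pi>01: "\<pi> X \<in> {0..1}" for X
    using le1 ge0 by (simp add: \<pi>_def)
  have "\<pi> X \<le> \<pi> Y" if "X \<subseteq> Y" "Y \<subseteq> worlds K" for X Y
  proof (cases "Y = worlds K")
    case True
    then show ?thesis
      using \<pi>01[of X] by (simp add: \<pi>_def)
  next
    case False
    have "Sup (below X) \<le> Sup (below Y)"
      by (rule cSup_subset_mono[OF _ bdd]) (use that in \<open>auto simp: below_def\<close>)
    then show ?thesis
      using False that by (auto simp: \<pi>_def)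
  qed
  moreover have "\<pi> {} = 0" "\<pi> (worlds K) = 1"
    using K(1,3) by (auto simp: \<pi>_def below_def is_bd_model_def)
  ultimately have "is_cb_model M"
    using K(1) \<pi>01 by (simp add: is_cb_model_def uncertainty_measure_def M_def is_bd_model_def)
  moreover have "measure M (ext_pos M \<phi>) = p \<phi>" for \<phi>
  proof -
    have "supp_pos M w \<psi> = supp_pos K w \<psi>" for w \<psi>
      by (rule supp_cong; simp add: M_def)
    then have "ext_pos M \<phi> = ext_pos K \<phi>"
      by (simp add: ext_pos_def) (simp add: M_def)
    moreover have "Sup (below (ext_pos K \<phi>)) = p \<phi>"
      by (rule cSup_eq_maximum) (use bounds mono K(2) in \<open>auto simp: below_def\<close>)
    ultimately show ?thesis
      using K(4) by (simp add: M_def \<pi>_def)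
  qed
  ultimately show ?thesis by blast
qed

definition dual_cb_model :: "'w cb_model \<Rightarrow> 'w cb_model" where
  "dual_cb_model M = \<lparr>worlds = worlds M, vpos = (\<lambda>p. worlds M - vneg M p),
     vneg = (\<lambda>p. worlds M - vpos M p), measure = (\<lambda>X. 1 - measure M (worlds M - X))\<rparr>"

lemma is_cb_model_dual:
  assumes "is_cb_model M"
  shows "is_cb_model (dual_cb_model M)"
proof -
  have "measure M {} \<in> {0..1}" "measure M (worlds M - X) \<in> {0..1}" for X
    using assms by (auto simp: is_cb_model_def uncertainty_measure_def)
  then show ?thesis
    using assms Diff_mono[OF order_refl, of _ _ "worlds M"]
    by (auto simp: is_cb_model_def uncertainty_measure_def dual_cb_model_def is_bd_model_def
        simp del: Diff_subset_conv)
qed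

lemma measure_dual:
  "measure (dual_cb_model M) (ext_pos (dual_cb_model M) \<phi>) = 1 - measure M (ext_neg M \<phi>)"
  "measure (dual_cb_model M) (ext_neg (dual_cb_model M) \<phi>) = 1 - measure M (ext_pos M \<phi>)"
proof -
  let ?D = "dual_cb_model M"
  have "supp_pos ?D w \<phi> \<longleftrightarrow> \<not> supp_neg M w \<phi>" "supp_neg ?D w \<phi> \<longleftrightarrow> \<not> supp_pos M w \<phi>"
    if "w \<in> worlds M" for w
    by (rule supp_dual; use that in \<open>simp add: dual_cb_model_def\<close>)+
  then have "worlds M - ext_pos ?D \<phi> = ext_neg M \<phi>" "worlds M - ext_neg ?D \<phi> = ext_pos M \<phi>"
    by (auto simp: ext_pos_def ext_neg_def) (auto simp: dual_cb_model_def)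
  then show "measure ?D (ext_pos ?D \<phi>) = 1 - measure M (ext_neg M \<phi>)"
      "measure ?D (ext_neg ?D \<phi>) = 1 - measure M (ext_pos M \<phi>)"
    by (simp_all add: dual_cb_model_def)
qed

section \<open>Semantics and axioms of the outer logics\<close>

lemma measure_bounds:
  assumes "is_cb_model M"
  shows "measure M (ext_pos M \<phi>) \<in> {0..1}" "measure M (ext_neg M \<phi>) \<in> {0..1}"
  using assms by (auto simp: is_cb_model_def uncertainty_measure_def ext_pos_def ext_neg_def)

lemma measure_ext_mono:
  assumes "is_cb_model M" "bd_valid \<phi> \<chi>"
  shows "measure M (ext_pos M \<phi>) \<le> measure M (ext_pos M \<chi>)"
    "measure M (ext_neg M \<chi>) \<le> measure M (ext_neg M \<phi>)"
proof -
  have mono: "X \<subseteq> Y \<Longrightarrow> Y \<subseteq> worlds M \<Longrightarrow> measure M X \<le> measure M Y" for X Y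
    using assms(1) by (simp add: is_cb_model_def uncertainty_measure_def)
  have M: "is_bd_model M"
    using assms(1) by (simp add: is_cb_model_def)
  show "measure M (ext_pos M \<phi>) \<le> measure M (ext_pos M \<chi>)"
    by (rule mono[OF ext_mono_if_bd_valid(1)[OF assms(2) M]]) (auto simp: ext_pos_def)
  show "measure M (ext_neg M \<chi>) \<le> measure M (ext_neg M \<phi>)"
    by (rule mono[OF ext_mono_if_bd_valid(2)[OF assms(2) M]]) (auto simp: ext_neg_def)
qed

lemma ext_pos_BNeg_BNeg: "ext_pos M (BNeg (BNeg \<phi>)) = ext_pos M \<phi>"
  by (simp add: ext_pos_def)

text \<open>
  The atom \<open>0\<close>, the one in \<open>\<top>\<close> and \<open>\<bottom>\<close>, is sent to a prescribed formula \<open>\<gamma>\<close>; the others enumerate all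
  formulas, so that every formula is the value of some atom.
\<close>

definition enum_subst :: "'a::countable \<Rightarrow> nat \<Rightarrow> 'a" where
  "enum_subst \<gamma> n = (case n of 0 \<Rightarrow> \<gamma> | Suc k \<Rightarrow> from_nat k)"

section \<open>The logic \<open>MCB\<close>\<close>

lemma g2_subst_enum: "g2_subst (enum_subst \<gamma>) (Atom (Suc (to_nat \<phi>))) = \<phi>"
  by (simp add: enum_subst_def)

lemma mcb_thm_axiom:
  fixes \<gamma> :: mcb
  assumes "g2_axiom \<gamma> \<phi>"
  shows "mcb_thm \<phi>"
proof -
  interpret biG_signature And Or Imp Coimp \<gamma> .
  let ?h = "g2_subst (enum_subst \<gamma>)"
  have "surj ?h"
    by (rule surjI) (rule g2_subst_enum)
  then obtain \<phi>' where "g2_axiom (Atom 0) \<phi>'" "?h \<phi>' = \<phi>"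
    using axiom_surj_image[of ?h And Or Imp Coimp "Atom 0"] assms by (auto simp: enum_subst_def)
  then show ?thesis
    using mcb_thm.inst[OF g2_thm.biG] by blast
qed

lemma mcb_thm_neg:
  "mcb_thm (Iff (Neg (Neg \<phi>)) \<phi>)"
  "mcb_thm (Iff (Neg (And \<phi> \<chi>)) (Or (Neg \<phi>) (Neg \<chi>)))"
  "mcb_thm (Iff (Neg (Or \<phi> \<chi>)) (And (Neg \<phi>) (Neg \<chi>)))"
  "mcb_thm (Iff (Neg (Imp \<phi> \<chi>)) (Coimp (Neg \<chi>) (Neg \<phi>)))"
  "mcb_thm (Iff (Neg (Coimp \<phi> \<chi>)) (Imp (Neg \<chi>) (Neg \<phi>)))"
proof -
  let ?x = "Atom (Suc (to_nat \<phi>))" and ?y = "Atom (Suc (to_nat \<chi>))" and ?\<sigma> = "enum_subst \<phi>"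
  show "mcb_thm (Iff (Neg (Neg \<phi>)) \<phi>)"
    using mcb_thm.inst[OF g2_thm.neg_neg[of ?x], of ?\<sigma>] by (simp add: g2_subst_enum del: g2_subst.simps(1))
  show "mcb_thm (Iff (Neg (And \<phi> \<chi>)) (Or (Neg \<phi>) (Neg \<chi>)))"
    using mcb_thm.inst[OF g2_thm.neg_and[of ?x ?y], of ?\<sigma>] by (simp add: g2_subst_enum del: g2_subst.simps(1))
  show "mcb_thm (Iff (Neg (Or \<phi> \<chi>)) (And (Neg \<phi>) (Neg \<chi>)))"
    using mcb_thm.inst[OF g2_thm.neg_or[of ?x ?y], of ?\<sigma>] by (simp add: g2_subst_enum del: g2_subst.simps(1))
  show "mcb_thm (Iff (Neg (Imp \<phi> \<chi>)) (Coimp (Neg \<chi>) (Neg \<phi>)))"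
    using mcb_thm.inst[OF g2_thm.neg_imp[of ?x ?y], of ?\<sigma>] by (simp add: g2_subst_enum del: g2_subst.simps(1))
  show "mcb_thm (Iff (Neg (Coimp \<phi> \<chi>)) (Imp (Neg \<chi>) (Neg \<phi>)))"
    using mcb_thm.inst[OF g2_thm.neg_coimp[of ?x ?y], of ?\<sigma>] by (simp add: g2_subst_enum del: g2_subst.simps(1))
qed

interpretation mcb: biG_logic And Or Imp Coimp "C (PVar 0)" mcb_thm
  by unfold_locales (fact mcb_thm_axiom mcb_thm.mp mcb_thm.nec)+

lemma mcb_derives_iff:
  "mcb_derives \<Psi> \<alpha> \<longleftrightarrow> (\<forall>D. mcb.deductive mcb_thm D \<longrightarrow> \<Psi> \<subseteq> D \<longrightarrow> \<alpha> \<in> D)"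
proof
  assume "mcb_derives \<Psi> \<alpha>"
  then show "\<forall>D. mcb.deductive mcb_thm D \<longrightarrow> \<Psi> \<subseteq> D \<longrightarrow> \<alpha> \<in> D"
    unfolding mcb.deductive_def by induction blast+
next
  assume *: "\<forall>D. mcb.deductive mcb_thm D \<longrightarrow> \<Psi> \<subseteq> D \<longrightarrow> \<alpha> \<in> D"
  have "mcb.deductive mcb_thm {\<phi>. mcb_derives \<Psi> \<phi>}"
    unfolding mcb.deductive_def by (blast intro: mcb_derives.intros)
  with * show "mcb_derives \<Psi> \<alpha>"
    by (blast intro: mcb_derives.intros)
qed

lemma g2_bounds:
  assumes "\<And>a. f1 a \<in> {0..1}" "\<And>a. f2 a \<in> {0..1}"
  shows "g2_e1 f1 f2 \<phi> \<in> {0..1} \<and> g2_e2 f1 f2 \<phi> \<in> {0..1}"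
  using assms by (induction \<phi>) (auto simp: biG_imp_def biG_coimp_def min_le_iff_disj le_max_iff_disj)

lemma g2_valuation:
  assumes "\<And>a. f1 a \<in> {0..1}" "\<And>a. f2 a \<in> {0..1}"
  shows "biG_signature.valuation And Or Imp Coimp (g2_e1 f1 f2)"
  using g2_bounds[of f1 f2] assms by (simp add: biG_signature.valuation_def)

lemma g2_e1_Iff: "g2_e1 f1 f2 \<phi> = g2_e1 f1 f2 \<chi> \<Longrightarrow> g2_e1 f1 f2 (Iff \<phi> \<chi>) = 1"
  by (simp add: biG_imp_def)

lemma g2_thm_sound:
  assumes "g2_thm \<phi>" "\<And>a. f1 a \<in> {0..1}" "\<And>a. f2 a \<in> {0..1}"
  shows "g2_e1 f1 f2 \<phi> = 1"
proof -
  note val = g2_valuation[of f1 f2, OF assms(2,3)]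
  show ?thesis
    using assms(1)
  proof induction
    case (biG \<phi>)
    then show ?case by (rule biG_signature.valuation_axiom[OF val])
  next
    case (mp \<phi> \<chi>)
    show ?case by (rule biG_signature.valuation_mp[OF val mp.IH])
  next
    case (nec \<phi>)
    show ?case by (rule biG_signature.valuation_delta[OF val nec.IH])
  qed (rule g2_e1_Iff, simp)+
qed

lemma g2_e_subst:
  "g2_e1 f1 f2 (g2_subst \<sigma> \<phi>) = g2_e1 (g2_e1 f1 f2 \<circ> \<sigma>) (g2_e2 f1 f2 \<circ> \<sigma>) \<phi>"
  "g2_e2 f1 f2 (g2_subst \<sigma> \<phi>) = g2_e2 (g2_e1 f1 f2 \<circ> \<sigma>) (g2_e2 f1 f2 \<circ> \<sigma>) \<phi>"
  by (induction \<phi>) auto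

lemma g2_measure_bounds:
  assumes "is_cb_model M"
  shows "g2_e1 (\<lambda>\<phi>. measure M (ext_pos M \<phi>)) (\<lambda>\<phi>. measure M (ext_neg M \<phi>)) \<alpha> \<in> {0..1}"
    "g2_e2 (\<lambda>\<phi>. measure M (ext_pos M \<phi>)) (\<lambda>\<phi>. measure M (ext_neg M \<phi>)) \<alpha> \<in> {0..1}"
  using g2_bounds[of "\<lambda>\<phi>. measure M (ext_pos M \<phi>)" "\<lambda>\<phi>. measure M (ext_neg M \<phi>)" \<alpha>]
    measure_bounds[OF assms] by blast+

lemma mcb_e1_valuation:
  assumes "is_cb_model M"
  shows "mcb.valuation (mcb_e1 M)"
  unfolding mcb_e1_def using measure_bounds[OF assms] by (intro g2_valuation)

lemma mcb_thm_sound: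
  assumes "mcb_thm \<alpha>" and M: "is_cb_model M"
  shows "mcb_e1 M \<alpha> = 1"
  using assms(1)
proof induction
  case (inst \<phi> \<sigma>)
  show ?case
    unfolding mcb_e1_def g2_e_subst
    by (rule g2_thm_sound[OF inst]) (simp_all only: comp_apply g2_measure_bounds[OF M])
next
  case (mono \<phi> \<chi>)
  then show ?case
    using measure_ext_mono[OF M mono]
    by (simp add: mcb_e1_def biG_imp_def)
next
  case (neg \<phi>)
  then show ?case
    by (simp only: mcb_e1_def g2_e1.simps g2_e2.simps biG_imp_def ext_neg_eq_ext_pos
        ext_pos_BNeg_BNeg order_refl if_True min.idem)
next
  case (mp \<alpha> \<beta>)
  show ?case by (rule mcb.valuation_mp[OF mcb_e1_valuation[OF M] mp.IH])
next
  case (nec \<alpha> \<gamma>)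
  show ?case
    by (rule biG_signature.valuation_delta[OF mcb_e1_valuation[OF M] nec.IH])
qed

lemma mcb_soundness:
  assumes "mcb_derives \<Psi> \<alpha>" "is_cb_model M"
  shows "unit_Inf (mcb_e1 M ` \<Psi>) \<le> mcb_e1 M \<alpha>"
proof -
  let ?D = "{\<phi>. unit_Inf (mcb_e1 M ` \<Psi>) \<le> mcb_e1 M \<phi>}"
  have "mcb.deductive mcb_thm ?D" "\<Psi> \<subseteq> ?D"
    using mcb.deductive_unit_Inf[OF mcb_e1_valuation mcb_thm_sound] assms(2) by blast+
  then have "\<alpha> \<in> ?D"
    using assms(1) unfolding mcb_derives_iff by blast
  then show ?thesis
    by simp
qed

text \<open>
  The separating valuation \<open>v\<close> is realised on the formulas \<open>C \<phi>\<close> by a measure.  By the axiom for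
  \<open>C \<not>\<phi>\<close>, the value \<open>e\<^sub>2(C \<phi>) = \<pi>(|\<not>\<phi>|\<^sup>+)\<close> is \<open>v(\<not>C \<phi>)\<close>, and the axioms that push \<open>\<not>\<close> inwards mirror
  the clauses of \<open>e\<^sub>2\<close>; so \<open>e\<^sub>1 = v\<close> and \<open>e\<^sub>2 = v \<circ> \<not>\<close> on all formulas.
\<close>

lemma mcb_completeness:
  assumes "infinite (UNIV :: 'w set)"
    and entails: "\<And>M :: 'w cb_model. is_cb_model M \<Longrightarrow> unit_Inf (mcb_e1 M ` \<Psi>) \<le> mcb_e1 M \<alpha>"
  shows "mcb_derives \<Psi> \<alpha>"
proof (rule ccontr)
  assume "\<not> mcb_derives \<Psi> \<alpha>"
  then obtain D where D: "mcb.deductive mcb_thm D" "\<Psi> \<subseteq> D" "\<alpha> \<notin> D"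
    unfolding mcb_derives_iff by blast
  obtain v where v: "mcb.valuation v" "\<And>\<phi>. mcb_thm \<phi> \<Longrightarrow> v \<phi> = 1" "v \<alpha> \<le> 1/3"
      "\<And>\<psi>. \<psi> \<in> D \<Longrightarrow> 2/3 \<le> v \<psi>"
    using mcb.separating_valuation[OF inj_to_nat D(1,3)] by blast
  note simps = mcb.valuation_simps[OF v(1)] and bounds = mcb.valuation_bounds[OF v(1)]
  note one = mcb.valuation_imp_iff[OF v(1)] mcb.valuation_conj_iff[OF v(1)]
  have iff: "v \<phi> = v \<chi>" if "mcb_thm (Iff \<phi> \<chi>)" for \<phi> \<chi>
    using v(2)[OF that] by (auto simp: one intro: antisym)
  have "v (C \<phi>) \<le> v (C \<chi>)" if "bd_valid \<phi> \<chi>" for \<phi> \<chi>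
    using v(2)[OF mcb_thm.mono[OF that]] by (simp only: one)
  then obtain M :: "'w cb_model" where M: "is_cb_model M" "\<And>\<phi>. measure M (ext_pos M \<phi>) = v (C \<phi>)"
    using cb_model_realizing[OF assms(1), of "v \<circ> C"] bounds by auto
  have negC: "v (C (BNeg \<phi>)) = v (Neg (C \<phi>))" for \<phi>
    by (rule iff[OF mcb_thm.neg])
  have "g2_e1 (\<lambda>\<phi>. measure M (ext_pos M \<phi>)) (\<lambda>\<phi>. measure M (ext_neg M \<phi>)) \<phi> = v \<phi> \<and>
        g2_e2 (\<lambda>\<phi>. measure M (ext_pos M \<phi>)) (\<lambda>\<phi>. measure M (ext_neg M \<phi>)) \<phi> = v (Neg \<phi>)" for \<phi>
    by (induction \<phi>) (simp_all add: M(2) ext_neg_eq_ext_pos negC simps iff[OF mcb_thm_neg(1)]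
        iff[OF mcb_thm_neg(2)] iff[OF mcb_thm_neg(3)] iff[OF mcb_thm_neg(4)] iff[OF mcb_thm_neg(5)])
  then have e: "mcb_e1 M = v"
    by (auto simp: mcb_e1_def)
  have "2/3 \<le> unit_Inf (v ` \<Psi>)"
    using v(4) D(2) cINF_greatest[of \<Psi> "2/3" v] by (auto simp: unit_Inf_def)
  then show False
    using entails[OF M(1)] v(3) by (simp add: e)
qed

section \<open>The logic \<open>NMCB\<close>\<close>

lemma n2_subst_enum: "n2_subst (enum_subst \<gamma>) (NAtom (Suc (to_nat \<phi>))) = \<phi>"
  by (simp add: enum_subst_def)

lemma nmcb_thm_axiom:
  fixes \<gamma> :: nmcb
  assumes "n2_axiom \<gamma> \<phi>"
  shows "nmcb_thm \<phi>"
proof -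
  interpret biG_signature NAnd NOr NImp NCoimp \<gamma> .
  let ?h = "n2_subst (enum_subst \<gamma>)"
  have "surj ?h"
    by (rule surjI) (rule n2_subst_enum)
  then obtain \<phi>' where "n2_axiom (NAtom 0) \<phi>'" "?h \<phi>' = \<phi>"
    using axiom_surj_image[of ?h NAnd NOr NImp NCoimp "NAtom 0"] assms by (auto simp: enum_subst_def)
  then show ?thesis
    using nmcb_thm.inst[OF n2_thm.biG] by blast
qed

lemma nmcb_thm_neg:
  "nmcb_thm (NIff (NNeg (NNeg \<phi>)) \<phi>)"
  "nmcb_thm (NIff (NNeg (NAnd \<phi> \<chi>)) (NOr (NNeg \<phi>) (NNeg \<chi>)))"
  "nmcb_thm (NIff (NNeg (NOr \<phi> \<chi>)) (NAnd (NNeg \<phi>) (NNeg \<chi>)))"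
  "nmcb_thm (NIff (NNeg (NImp \<phi> \<chi>)) (NAnd \<phi> (NNeg \<chi>)))"
  "nmcb_thm (NIff (NNeg (NCoimp \<phi> \<chi>)) (NOr (NNeg \<phi>) \<chi>))"
proof -
  let ?x = "NAtom (Suc (to_nat \<phi>))" and ?y = "NAtom (Suc (to_nat \<chi>))" and ?\<sigma> = "enum_subst \<phi>"
  show "nmcb_thm (NIff (NNeg (NNeg \<phi>)) \<phi>)"
    using nmcb_thm.inst[OF n2_thm.neg_neg[of ?x], of ?\<sigma>] by (simp add: n2_subst_enum del: n2_subst.simps(1))
  show "nmcb_thm (NIff (NNeg (NAnd \<phi> \<chi>)) (NOr (NNeg \<phi>) (NNeg \<chi>)))"
    using nmcb_thm.inst[OF n2_thm.neg_and[of ?x ?y], of ?\<sigma>] by (simp add: n2_subst_enum del: n2_subst.simps(1))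
  show "nmcb_thm (NIff (NNeg (NOr \<phi> \<chi>)) (NAnd (NNeg \<phi>) (NNeg \<chi>)))"
    using nmcb_thm.inst[OF n2_thm.neg_or[of ?x ?y], of ?\<sigma>] by (simp add: n2_subst_enum del: n2_subst.simps(1))
  show "nmcb_thm (NIff (NNeg (NImp \<phi> \<chi>)) (NAnd \<phi> (NNeg \<chi>)))"
    using nmcb_thm.inst[OF n2_thm.neg_imp[of ?x ?y], of ?\<sigma>] by (simp add: n2_subst_enum del: n2_subst.simps(1))
  show "nmcb_thm (NIff (NNeg (NCoimp \<phi> \<chi>)) (NOr (NNeg \<phi>) \<chi>))"
    using nmcb_thm.inst[OF n2_thm.neg_coimp[of ?x ?y], of ?\<sigma>] by (simp add: n2_subst_enum del: n2_subst.simps(1))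
qed

interpretation nmcb: biG_logic NAnd NOr NImp NCoimp "NC (PVar 0)" nmcb_thm
  by unfold_locales (fact nmcb_thm_axiom nmcb_thm.mp nmcb_thm.nec)+

lemma nmcb_derives_iff:
  "nmcb_derives \<Psi> \<alpha> \<longleftrightarrow> (\<forall>D. nmcb.deductive nmcb_thm D \<longrightarrow> \<Psi> \<subseteq> D \<longrightarrow> \<alpha> \<in> D)"
proof
  assume "nmcb_derives \<Psi> \<alpha>"
  then show "\<forall>D. nmcb.deductive nmcb_thm D \<longrightarrow> \<Psi> \<subseteq> D \<longrightarrow> \<alpha> \<in> D"
    unfolding nmcb.deductive_def by induction blast+
next
  assume *: "\<forall>D. nmcb.deductive nmcb_thm D \<longrightarrow> \<Psi> \<subseteq> D \<longrightarrow> \<alpha> \<in> D"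
  have "nmcb.deductive nmcb_thm {\<phi>. nmcb_derives \<Psi> \<phi>}"
    unfolding nmcb.deductive_def by (blast intro: nmcb_derives.intros)
  with * show "nmcb_derives \<Psi> \<alpha>"
    by (blast intro: nmcb_derives.intros)
qed

lemma n2_bounds:
  assumes "\<And>a. f1 a \<in> {0..1}" "\<And>a. f2 a \<in> {0..1}"
  shows "n2_e1 f1 f2 \<phi> \<in> {0..1} \<and> n2_e2 f1 f2 \<phi> \<in> {0..1}"
  using assms by (induction \<phi>) (auto simp: biG_imp_def biG_coimp_def min_le_iff_disj le_max_iff_disj)

lemma n2_valuation:
  assumes "\<And>a. f1 a \<in> {0..1}" "\<And>a. f2 a \<in> {0..1}"
  shows "biG_signature.valuation NAnd NOr NImp NCoimp (n2_e1 f1 f2)"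
  using n2_bounds[of f1 f2] assms by (simp add: biG_signature.valuation_def)

lemma n2_e1_Iff: "n2_e1 f1 f2 \<phi> = n2_e1 f1 f2 \<chi> \<Longrightarrow> n2_e1 f1 f2 (NIff \<phi> \<chi>) = 1"
  by (simp add: biG_imp_def)

lemma n2_thm_sound:
  assumes "n2_thm \<phi>" "\<And>a. f1 a \<in> {0..1}" "\<And>a. f2 a \<in> {0..1}"
  shows "n2_e1 f1 f2 \<phi> = 1"
proof -
  note val = n2_valuation[of f1 f2, OF assms(2,3)]
  show ?thesis
    using assms(1)
  proof induction
    case (biG \<phi>)
    then show ?case by (rule biG_signature.valuation_axiom[OF val])
  next
    case (mp \<phi> \<chi>)
    show ?case by (rule biG_signature.valuation_mp[OF val mp.IH])
  next
    case (nec \<phi>)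
    show ?case by (rule biG_signature.valuation_delta[OF val nec.IH])
  qed (rule n2_e1_Iff, simp)+
qed

lemma n2_e_subst:
  "n2_e1 f1 f2 (n2_subst \<sigma> \<phi>) = n2_e1 (n2_e1 f1 f2 \<circ> \<sigma>) (n2_e2 f1 f2 \<circ> \<sigma>) \<phi>"
  "n2_e2 f1 f2 (n2_subst \<sigma> \<phi>) = n2_e2 (n2_e1 f1 f2 \<circ> \<sigma>) (n2_e2 f1 f2 \<circ> \<sigma>) \<phi>"
  by (induction \<phi>) auto

lemma n2_measure_bounds:
  assumes "is_cb_model M"
  shows "n2_e1 (\<lambda>\<phi>. measure M (ext_pos M \<phi>)) (\<lambda>\<phi>. measure M (ext_neg M \<phi>)) \<alpha> \<in> {0..1}"
    "n2_e2 (\<lambda>\<phi>. measure M (ext_pos M \<phi>)) (\<lambda>\<phi>. measure M (ext_neg M \<phi>)) \<alpha> \<in> {0..1}"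
  using n2_bounds[of "\<lambda>\<phi>. measure M (ext_pos M \<phi>)" "\<lambda>\<phi>. measure M (ext_neg M \<phi>)" \<alpha>]
    measure_bounds[OF assms] by blast+

lemma nmcb_e1_valuation:
  assumes "is_cb_model M"
  shows "nmcb.valuation (nmcb_e1 M)"
  unfolding nmcb_e1_def using measure_bounds[OF assms] by (intro n2_valuation)

lemma nmcb_thm_sound:
  assumes "nmcb_thm \<alpha>" and M: "is_cb_model M"
  shows "nmcb_e1 M \<alpha> = 1"
  using assms(1)
proof induction
  case (inst \<phi> \<sigma>)
  show ?case
    unfolding nmcb_e1_def n2_e_subst
    by (rule n2_thm_sound[OF inst]) (simp_all only: comp_apply n2_measure_bounds[OF M])
next
  case (mono \<phi> \<chi>)
  then show ?case
    using measure_ext_mono[OF M mono]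
    by (simp add: nmcb_e1_def biG_imp_def)
next
  case (neg \<phi>)
  then show ?case
    by (simp only: nmcb_e1_def n2_e1.simps n2_e2.simps biG_imp_def ext_neg_eq_ext_pos
        ext_pos_BNeg_BNeg order_refl if_True min.idem)
next
  case (mp \<alpha> \<beta>)
  show ?case by (rule nmcb.valuation_mp[OF nmcb_e1_valuation[OF M] mp.IH])
next
  case (nec \<alpha> \<gamma>)
  show ?case
    by (rule biG_signature.valuation_delta[OF nmcb_e1_valuation[OF M] nec.IH])
qed

lemma nmcb_soundness:
  assumes "nmcb_derives \<Psi> \<alpha>" "is_cb_model M"
  shows "unit_Inf (nmcb_e1 M ` \<Psi>) \<le> nmcb_e1 M \<alpha>"
proof -
  let ?D = "{\<phi>. unit_Inf (nmcb_e1 M ` \<Psi>) \<le> nmcb_e1 M \<phi>}"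
  have "nmcb.deductive nmcb_thm ?D" "\<Psi> \<subseteq> ?D"
    using nmcb.deductive_unit_Inf[OF nmcb_e1_valuation nmcb_thm_sound] assms(2) by blast+
  then have "\<alpha> \<in> ?D"
    using assms(1) unfolding nmcb_derives_iff by blast
  then show ?thesis
    by simp
qed

text \<open>
  As for \<open>MCB\<close>; only the axioms for \<open>\<not>\<close> of the two implications, and with them the clauses of \<open>e\<^sub>2\<close>, are
  different.
\<close>

lemma nmcb_completeness:
  assumes "infinite (UNIV :: 'w set)"
    and entails: "\<And>M :: 'w cb_model. is_cb_model M \<Longrightarrow> unit_Inf (nmcb_e1 M ` \<Psi>) \<le> nmcb_e1 M \<alpha>"
  shows "nmcb_derives \<Psi> \<alpha>"
proof (rule ccontr)
  assume "\<not> nmcb_derives \<Psi> \<alpha>"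
  then obtain D where D: "nmcb.deductive nmcb_thm D" "\<Psi> \<subseteq> D" "\<alpha> \<notin> D"
    unfolding nmcb_derives_iff by blast
  obtain v where v: "nmcb.valuation v" "\<And>\<phi>. nmcb_thm \<phi> \<Longrightarrow> v \<phi> = 1" "v \<alpha> \<le> 1/3"
      "\<And>\<psi>. \<psi> \<in> D \<Longrightarrow> 2/3 \<le> v \<psi>"
    using nmcb.separating_valuation[OF inj_to_nat D(1,3)] by blast
  note simps = nmcb.valuation_simps[OF v(1)] and bounds = nmcb.valuation_bounds[OF v(1)]
  note one = nmcb.valuation_imp_iff[OF v(1)] nmcb.valuation_conj_iff[OF v(1)]
  have iff: "v \<phi> = v \<chi>" if "nmcb_thm (NIff \<phi> \<chi>)" for \<phi> \<chi>
    using v(2)[OF that] by (auto simp: one intro: antisym)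
  have "v (NC \<phi>) \<le> v (NC \<chi>)" if "bd_valid \<phi> \<chi>" for \<phi> \<chi>
    using v(2)[OF nmcb_thm.mono[OF that]] by (simp only: one)
  then obtain M :: "'w cb_model" where M: "is_cb_model M" "\<And>\<phi>. measure M (ext_pos M \<phi>) = v (NC \<phi>)"
    using cb_model_realizing[OF assms(1), of "v \<circ> NC"] bounds by auto
  have negC: "v (NC (BNeg \<phi>)) = v (NNeg (NC \<phi>))" for \<phi>
    using v(2)[OF nmcb_thm.neg[of \<phi>]] by (auto simp: one intro: antisym)
  have "n2_e1 (\<lambda>\<phi>. measure M (ext_pos M \<phi>)) (\<lambda>\<phi>. measure M (ext_neg M \<phi>)) \<phi> = v \<phi> \<and>
        n2_e2 (\<lambda>\<phi>. measure M (ext_pos M \<phi>)) (\<lambda>\<phi>. measure M (ext_neg M \<phi>)) \<phi> = v (NNeg \<phi>)" for \<phi>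
    by (induction \<phi>) (simp_all add: M(2) ext_neg_eq_ext_pos negC simps iff[OF nmcb_thm_neg(1)]
        iff[OF nmcb_thm_neg(2)] iff[OF nmcb_thm_neg(3)] iff[OF nmcb_thm_neg(4)] iff[OF nmcb_thm_neg(5)])
  then have e: "nmcb_e1 M = v"
    by (auto simp: nmcb_e1_def)
  have "2/3 \<le> unit_Inf (v ` \<Psi>)"
    using v(4) D(2) cINF_greatest[of \<Psi> "2/3" v] by (auto simp: unit_Inf_def)
  then show False
    using entails[OF M(1)] v(3) by (simp add: e)
qed

section \<open>Duality for \<open>MCB\<close>\<close>

text \<open>
  The map \<open>x \<mapsto> 1 - x\<close> exchanges \<open>\<rightarrow>\<close> and \<open>\<prec>\<close> with swapped arguments, which is the relation between
  the clauses of \<open>e\<^sub>1\<close> and \<open>e\<^sub>2\<close>.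
\<close>

lemma g2_e_dual:
  "g2_e1 (\<lambda>a. 1 - f2 a) (\<lambda>a. 1 - f1 a) \<phi> = 1 - g2_e2 f1 f2 \<phi> \<and>
   g2_e2 (\<lambda>a. 1 - f2 a) (\<lambda>a. 1 - f1 a) \<phi> = 1 - g2_e1 f1 f2 \<phi>"
  by (induction \<phi>) (auto simp: biG_imp_def biG_coimp_def)

lemma mcb_e1_dual: "mcb_e1 (dual_cb_model M) \<phi> = 1 - mcb_e2 M \<phi>"
  unfolding mcb_e1_def mcb_e2_def measure_dual by (rule g2_e_dual[THEN conjunct1])

lemma unit_Inf_le_unit_Sup:
  assumes "\<And>\<psi>. f \<psi> \<le> 1"
  shows "1 - unit_Sup (f ` \<Psi>) \<le> unit_Inf ((\<lambda>\<psi>. 1 - f \<psi>) ` \<Psi>)"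
proof (cases "\<Psi> = {}")
  case False
  have "f \<psi> \<le> Sup (f ` \<Psi>)" if "\<psi> \<in> \<Psi>" for \<psi>
    using that assms by (intro cSUP_upper bdd_aboveI2)
  then show ?thesis
    using False by (force simp: unit_Inf_def unit_Sup_def intro!: cINF_greatest)
qed (simp add: unit_Inf_def unit_Sup_def)

lemma mcb_soundness_e2:
  assumes "mcb_derives \<Psi> \<alpha>" and M: "is_cb_model M"
  shows "mcb_e2 M \<alpha> \<le> unit_Sup (mcb_e2 M ` \<Psi>)"
proof -
  have "mcb_e2 M \<phi> \<le> 1" for \<phi>
    using g2_measure_bounds(2)[OF M, of \<phi>] by (simp add: mcb_e2_def)
  then have "1 - unit_Sup (mcb_e2 M ` \<Psi>) \<le> unit_Inf (mcb_e1 (dual_cb_model M) ` \<Psi>)"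
    using unit_Inf_le_unit_Sup[of "mcb_e2 M" \<Psi>] by (simp add: mcb_e1_dual[abs_def])
  also have "\<dots> \<le> 1 - mcb_e2 M \<alpha>"
    using mcb_soundness[OF assms(1) is_cb_model_dual[OF M]] by (simp add: mcb_e1_dual)
  finally show ?thesis by simp
qed

theorem theorem4p13:
  fixes \<Psi> :: "mcb set" and \<alpha> :: mcb and \<Omega> :: "nmcb set" and \<beta> :: nmcb
  assumes "infinite (UNIV :: 'w set)"
  shows "(mcb_derives \<Psi> \<alpha> \<longleftrightarrow> mcb_entails TYPE('w) \<Psi> \<alpha>) \<and>
         (nmcb_derives \<Omega> \<beta> \<longleftrightarrow> nmcb_entails TYPE('w) \<Omega> \<beta>)"
  using mcb_soundness mcb_soundness_e2 mcb_completeness[OF assms]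
    nmcb_soundness nmcb_completeness[OF assms]
  unfolding mcb_entails_def nmcb_entails_def by blast

end
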